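(* Let $\alpha_1>0$ be a constant such that $\left(\mathcal{A}^{(1)}v,v\right)\ge\alpha_1(\|v_{1,I}\|^2+\|v_{1,B}\|^2)$ for all vectors $v=[v_{1,I}\ v_{1,B}]^T$, let $\beta_1>0$ be a constant such that $\beta_1\|w\|_M^2\le\|w\|^2$ for all vectors $w$ indexed by the interface degrees of freedom, and put $r:=1/(1+\alpha_1\beta_1)<1$. Let $[u_{1,I}^*\ u_{1,B}^*]^T$, $[u_{2,I}^*\ u_{2,B}^*]^T$ be the solution of the monolithic system and, for an initial guess $u_{2,B}^0$, let $[u_{1,I}^m\ u_{1,B}^m]^T$, $[u_{2,I}^m\ u_{2,B}^m]^T$ $(m=1,2,\dots)$ be generated by the discrete Gauss-Seidel type iteration. Define $e_{i,\mu}^m:=u_{i,\mu}^m-u_{i,\mu}^*$ for $i=1,2$, $\mu\in\{I,B\}$ (and $e_{2,B}^0:=u_{2,B}^0-u_{2,B}^*$). Then there exists $C>0$, independent of $m$ and of the initial guess, such that $$\sqrt{\|e_{i,I}^m\|^2+\|e_{i,B}^m\|^2}\ \le\ C\,r^{m+i-2}\,\|e_{2,B}^0\|_M\qquad(i=1,2,\ m=1,2,\dots).$$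
   Context: Continuous setting. $d\in\{2,3\}$; $\Omega\subset\mathbb{R}^d$ is a bounded Lipschitz domain with $\Omega\setminus\Gamma=\Omega_1\cup\Omega_2$, $\Omega_1\cap\Omega_2=\emptyset$, where $\Gamma$ is a Lipschitz surface which is the common boundary of the two disjoint Lipschitz domains $\Omega_1,\Omega_2$. $\partial_D\Omega\subset\partial\Omega$ is the relatively open Dirichlet part of the boundary, with $\mathcal{H}^{d-1}(\partial_D\Omega)>0$ and $\partial_D\Omega\subset\partial\Omega_1$. $V_i:=\{u\in H^1(\Omega_i;\mathbb{R}^d):u=0\text{ on }\partial_D\Omega\cap\partial\Omega_i\}$. $e(u)$ is the symmetric gradient, $\sigma_{kl}(u)=\sum_{m,n}c_{klmn}e_{mn}(u)$, where $(c_{klmn})\in L^\infty(\Omega)$ has the symmetries $c_{klmn}=c_{mnkl}=c_{lkmn}$ and satisfies $\sum c_{klmn}(x)\xi_{kl}\xi_{mn}\ge c_*|\xi|^2$ for some $c_*>0$, a.e. $x\in\Omega$ and all symmetric $\xi\in\mathbb{R}^{d\times d}$. $\zeta\in L^\infty(\Gamma)$ with $\zeta(x)>0$ on $\Gamma$. $a_i(u,v):=\int_{\Omega_i}\sigma(u):e(v)\,dx$, $a_\Gamma(u,v):=\int_\Gamma\zeta u\cdot v\,ds$. Discretization. For $i=1,2$, $\{\varphi_k^{(i)}\}_{k\in\Lambda^{(i)}}\subset V_i$ is a finite (nodal) finite element basis on a mesh of $\Omega_i$ (in particular linearly independent), with $\Lambda^{(i)}=\Lambda_I^{(i)}\cup\Lambda_B^{(i)}$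 (disjoint), $\Lambda_I^{(i)}$ corresponding to nodes in $\overline{\Omega_i}\setminus\Gamma$ (these basis functions vanish on $\Gamma$) and $\Lambda_B^{(i)}$ to nodes on $\Gamma$ (traces on $\Gamma$ of these basis functions are linearly independent). The meshes coincide on $\Gamma$, so that $\Lambda_B^{(1)}$ and $\Lambda_B^{(2)}$ are identified and corresponding basis functions have equal traces on $\Gamma$. Matrices: $[A_{\mu\nu}^{(i)}]_{kl}=a_i(\varphi_l^{(i)},\varphi_k^{(i)})$ for $k\in\Lambda_\mu^{(i)}$, $l\in\Lambda_\nu^{(i)}$, $\mu,\nu\in\{I,B\}$; $[M]_{kl}=a_\Gamma(\varphi_l^{(j)},\varphi_k^{(i)})$, $k\in\Lambda_B^{(i)}$, $l\in\Lambda_B^{(j)}$, the same matrix for all $i,j\in\{1,2\}$. $M$ is positive definite. Set $$\mathcal{A}^{(i)}=\begin{bmatrix} A_{II}^{(i)} & A_{IB}^{(i)} \\ A_{BI}^{(i)} & A_{BB}^{(i)} \end{bmatrix},\qquad\widetilde{\mathcal{A}}^{(i)}=\begin{bmatrix} A_{II}^{(i)} & A_{IB}^{(i)} \\ A_{BI}^{(i)} & A_{BB}^{(i)}+M \end{bmatrix}.$$ $(\cdot,\cdot)$ and $\|\cdot\|$ are the Euclidean inner product and norm; $\|w\|_M:=(Mw,w)^{1/2}$. Monolithic system: given load vectors $f_{i,I},f_{i,B}$ (assembled from the body force and the Dirichlet and Neumann data), $$\begin{bmatrix} A_{II}^{(1)} & A_{IB}^{(1)} & 0 & 0 \\ A_{BI}^{(1)}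 & A_{BB}^{(1)}+M & -M & 0 \\ 0 & -M & A_{BB}^{(2)}+M & A_{BI}^{(2)} \\ 0 & 0 & A_{IB}^{(2)} & A_{II}^{(2)} \end{bmatrix}\begin{bmatrix} u_{1,I} \\ u_{1,B} \\ u_{2,B} \\ u_{2,I} \end{bmatrix}=\begin{bmatrix} f_{1,I} \\ f_{1,B} \\ f_{2,B} \\ f_{2,I} \end{bmatrix}.$$ Discrete Gauss-Seidel type iteration: from an initial guess $u_{2,B}^0$, for $m=1,2,\dots$ solve successively $$\widetilde{\mathcal{A}}^{(1)}\begin{bmatrix} u_{1,I}^m \\ u_{1,B}^m \end{bmatrix}=\begin{bmatrix} f_{1,I} \\ f_{1,B}+Mu_{2,B}^{m-1} \end{bmatrix},\qquad\widetilde{\mathcal{A}}^{(2)}\begin{bmatrix} u_{2,I}^m \\ u_{2,B}^m \end{bmatrix}=\begin{bmatrix} f_{2,I} \\ f_{2,B}+Mu_{1,B}^m \end{bmatrix}.$$ *)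

theory Defs
  imports "HOL-Analysis.Analysis" "Jordan_Normal_Form.Matrix"
begin

text \<open>Notation: \<open>real^'d\<close> with \<open>$\<close> is physical space; coefficient vectors and matrices, whose
  sizes are natural numbers (possibly 0), are those of \<^theory>\<open>Jordan_Normal_Form.Matrix\<close>, and
  \<open>\<bullet>\<close> is the scalar product of coefficient vectors.\<close>

no_notation vec_index (infixl \<open>$\<close> 100)
unbundle no inner_syntax
notation scalar_prod (infix \<open>\<bullet>\<close> 70)

subsection \<open>Hausdorff measure\<close>

text \<open>The normalisation \<open>\<omega>\<^sub>s (diam S / 2)^s\<close> makes the \<open>s\<close>-dimensional measure agree with surface
  area. The empty set is treated separately because of \<open>s = 0\<close>.\<close>

definition hausdorff_gauge :: "nat \<Rightarrow> 'a::metric_space set \<Rightarrow> ennreal" where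
  "hausdorff_gauge s S =
     (if S = {} then 0 else ennreal (unit_ball_vol (real s) * (diameter S / 2) ^ s))"

definition hausdorff_delta :: "nat \<Rightarrow> real \<Rightarrow> 'a::metric_space set \<Rightarrow> ennreal" where
  "hausdorff_delta s \<delta> A =
     (INF C \<in> {C :: nat \<Rightarrow> 'a set. A \<subseteq> (\<Union>i. C i) \<and> (\<forall>i. bounded (C i) \<and> diameter (C i) \<le> \<delta>)}.
        \<Sum>i. hausdorff_gauge s (C i))"

definition hausdorff_outer :: "nat \<Rightarrow> 'a::metric_space set \<Rightarrow> ennreal" where
  "hausdorff_outer s A = (SUP \<delta> \<in> {0<..}. hausdorff_delta s \<delta> A)"

definition hausdorff_measure :: "nat \<Rightarrow> 'a::metric_space measure" where
  "hausdorff_measure s = measure_of UNIV (sets borel) (hausdorff_outer s)"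

text \<open>\<open>measure_of\<close> yields the zero measure unless its argument is countably additive; lemma
  \<open>emeasure_hausdorff_measure\<close> below shows that it is.\<close>

lemma hausdorff_delta_le:
  assumes "A \<subseteq> (\<Union>i. C i)" "\<And>i. bounded (C i)" "\<And>i. diameter (C i) \<le> \<delta>"
  shows "hausdorff_delta s \<delta> A \<le> (\<Sum>i. hausdorff_gauge s (C i))"
  unfolding hausdorff_delta_def using assms by (intro INF_lower) auto

lemma hausdorff_delta_antimono: "d \<le> d' \<Longrightarrow> hausdorff_delta s d' A \<le> hausdorff_delta s d A"
  unfolding hausdorff_delta_def by (rule INF_superset_mono) (auto intro: order_trans)

lemma hausdorff_delta_mono: "A \<subseteq> B \<Longrightarrow> hausdorff_delta s d A \<le> hausdorff_delta s d B"
  unfolding hausdorff_delta_def by (rule INF_superset_mono) auto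

lemma hausdorff_delta_empty: "0 \<le> d \<Longrightarrow> hausdorff_delta s d {} = 0"
  using hausdorff_delta_le[of "{}" "\<lambda>_. {}" d s]
  by (simp add: hausdorff_gauge_def diameter_def)

lemma hausdorff_delta_close:
  assumes "hausdorff_delta s d A < \<infinity>" "0 < e"
  shows "\<exists>C. A \<subseteq> (\<Union>i. C i) \<and> (\<forall>i. bounded (C i) \<and> diameter (C i) \<le> d) \<and>
    (\<Sum>i. hausdorff_gauge s (C i)) < hausdorff_delta s d A + e"
proof -
  have "hausdorff_delta s d A < hausdorff_delta s d A + e"
    using assms by (simp add: ennreal_add_less_top less_top)
  then show ?thesis
    by (subst (asm) (1) hausdorff_delta_def) (auto simp: INF_less_iff)
qed

lemma hausdorff_delta_Union:
  "hausdorff_delta s d (\<Union>n. A n) \<le> (\<Sum>n. hausdorff_delta s d (A (n::nat)))"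
proof (rule ennreal_le_epsilon)
  fix e :: real assume fin: "(\<Sum>n. hausdorff_delta s d (A n)) < Orderings.top" and e: "0 < e"
  have "\<exists>C. A n \<subseteq> (\<Union>i. C i) \<and> (\<forall>i. bounded (C i) \<and> diameter (C i) \<le> d) \<and>
     (\<Sum>i. hausdorff_gauge s (C i)) < hausdorff_delta s d (A n) + e * (1/2)^Suc n" for n
  proof (rule hausdorff_delta_close)
    have "hausdorff_delta s d (A n) \<le> (\<Sum>n. hausdorff_delta s d (A n))"
      by (metis ennreal_suminf_lessD fin not_le order.strict_iff_order)
    then show "hausdorff_delta s d (A n) < \<infinity>" using fin by simp
    show "0 < ennreal (e * (1/2)^Suc n)" using e by simp
  qed
  then obtain C where C: "\<And>n. A n \<subseteq> (\<Union>i. C n i)"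
      "\<And>n i. bounded (C n i)" "\<And>n i. diameter (C n i) \<le> d"
      "\<And>n. (\<Sum>i. hausdorff_gauge s (C n i)) < hausdorff_delta s d (A n) + e * (1/2)^Suc n"
    by metis
  define D where "D i = case_prod C (prod_decode i)" for i
  have "(\<Union>n. A n) \<subseteq> (\<Union>i. D i)"
  proof
    fix x assume "x \<in> (\<Union>n. A n)"
    then obtain n i where "x \<in> C n i" using C(1) by blast
    then have "x \<in> D (prod_encode (n, i))" by (simp add: D_def)
    then show "x \<in> (\<Union>i. D i)" by blast
  qed
  then have "hausdorff_delta s d (\<Union>n. A n) \<le> (\<Sum>i. hausdorff_gauge s (D i))"
    by (rule hausdorff_delta_le) (auto simp: D_def C split: prod.split)
  also have "\<dots> = (\<Sum>i. (\<lambda>(n, i). hausdorff_gauge s (C n i)) (prod_decode i))"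
    by (simp add: D_def case_prod_beta)
  also have "\<dots> = (\<Sum>n. \<Sum>i. hausdorff_gauge s (C n i))"
    by (rule suminf_ennreal_2dimen) simp
  also have "\<dots> \<le> (\<Sum>n. hausdorff_delta s d (A n) + e * (1/2)^Suc n)"
    by (intro suminf_le less_imp_le C summableI)
  also have "\<dots> = (\<Sum>n. hausdorff_delta s d (A n)) + (\<Sum>n. ennreal (e * (1/2)^Suc n))"
    by (intro suminf_add[symmetric] summableI)
  also have "(\<Sum>n. ennreal (e * (1/2)^Suc n)) = ennreal e"
    using e power_half_series sums_mult[OF power_half_series, of e]
    by (intro suminf_ennreal_eq) auto
  finally show "hausdorff_delta s d (\<Union>n. A n) \<le> (\<Sum>n. hausdorff_delta s d (A n)) + ennreal e" .
qed

lemma hausdorff_outer_mono: "A \<subseteq> B \<Longrightarrow> hausdorff_outer s A \<le> hausdorff_outer s B"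
  unfolding hausdorff_outer_def by (intro SUP_mono' hausdorff_delta_mono)

lemma hausdorff_outer_metric:
  assumes e: "0 < e" and far: "\<And>x y. x \<in> A \<Longrightarrow> y \<in> B \<Longrightarrow> e \<le> dist x y"
  shows "hausdorff_outer s A + hausdorff_outer s B \<le> hausdorff_outer s (A \<union> B)"
proof -
  have sep: "hausdorff_delta s d A + hausdorff_delta s d B \<le> hausdorff_delta s d (A \<union> B)"
    if d: "0 < d" "d < e" for d
    unfolding hausdorff_delta_def[of s d "A \<union> B"]
  proof (rule INF_greatest, clarify)
    fix C :: "nat \<Rightarrow> 'a set"
    assume C: "A \<union> B \<subseteq> (\<Union>i. C i)" "\<forall>i. bounded (C i) \<and> diameter (C i) \<le> d"
    define CA where "CA i = (if C i \<inter> A = {} then {} else C i)" for i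
    define CB where "CB i = (if C i \<inter> B = {} then {} else C i)" for i
    have "hausdorff_delta s d A \<le> (\<Sum>i. hausdorff_gauge s (CA i))"
      using C d by (intro hausdorff_delta_le) (fastforce simp: CA_def)+
    moreover have "hausdorff_delta s d B \<le> (\<Sum>i. hausdorff_gauge s (CB i))"
      using C d by (intro hausdorff_delta_le) (fastforce simp: CB_def)+
    moreover have "(\<Sum>i. hausdorff_gauge s (CA i)) + (\<Sum>i. hausdorff_gauge s (CB i))
        \<le> (\<Sum>i. hausdorff_gauge s (C i))"
    proof (subst suminf_add)
      have one: "C i \<inter> A = {} \<or> C i \<inter> B = {}" for i
      proof (rule ccontr)
        assume "\<not> ?thesis"
        then obtain x y where xy: "x \<in> C i" "x \<in> A" "y \<in> C i" "y \<in> B" by auto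
        then have "dist x y \<le> diameter (C i)"
          using C(2) by (intro diameter_bounded_bound) auto
        with far[OF xy(2,4)] C(2) d show False by (smt (verit))
      qed
      have "hausdorff_gauge s (CA i) + hausdorff_gauge s (CB i) \<le> hausdorff_gauge s (C i)" for i
        using one[of i] by (auto simp: CA_def CB_def hausdorff_gauge_def)
      then show "(\<Sum>i. hausdorff_gauge s (CA i) + hausdorff_gauge s (CB i))
          \<le> (\<Sum>i. hausdorff_gauge s (C i))"
        by (intro suminf_le summableI)
    qed (auto intro: summableI)
    ultimately show "hausdorff_delta s d A + hausdorff_delta s d B
        \<le> (\<Sum>i. hausdorff_gauge s (C i))"
      by (meson add_mono order_trans)
  qed
  have "hausdorff_outer s A + hausdorff_outer s B
      = (SUP d\<in>{0<..}. hausdorff_delta s d A + hausdorff_delta s d B)"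
    unfolding hausdorff_outer_def
  proof (rule SUP_add_directed_ennreal[symmetric])
    fix i j :: real assume "i \<in> {0<..}" "j \<in> {0<..}"
    then show "\<exists>k\<in>{0<..}. hausdorff_delta s i A + hausdorff_delta s j B
        \<le> hausdorff_delta s k A + hausdorff_delta s k B"
      by (intro bexI[of _ "min i j"] add_mono hausdorff_delta_antimono) auto
  qed
  also have "\<dots> \<le> hausdorff_outer s (A \<union> B)"
  proof (rule SUP_least)
    fix d :: real assume d: "d \<in> {0<..}"
    have "hausdorff_delta s d A + hausdorff_delta s d B
       \<le> hausdorff_delta s (min d (e/2)) A + hausdorff_delta s (min d (e/2)) B"
      by (intro add_mono hausdorff_delta_antimono) auto
    also have "\<dots> \<le> hausdorff_delta s (min d (e/2)) (A \<union> B)"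
      using d e by (intro sep) auto
    also have "\<dots> \<le> hausdorff_outer s (A \<union> B)"
      unfolding hausdorff_outer_def using d e by (intro SUP_upper) auto
    finally show "hausdorff_delta s d A + hausdorff_delta s d B \<le> hausdorff_outer s (A \<union> B)" .
  qed
  finally show ?thesis .
qed

lemma hausdorff_outer_empty [simp]: "hausdorff_outer s {} = 0"
  by (auto simp: hausdorff_outer_def hausdorff_delta_empty)

lemma hausdorff_outer_Union:
  "hausdorff_outer s (\<Union>n. A n) \<le> (\<Sum>n. hausdorff_outer s (A (n::nat)))"
  unfolding hausdorff_outer_def[of s "\<Union>n. A n"]
proof (rule SUP_least)
  fix d :: real assume d: "d \<in> {0<..}"
  have "hausdorff_delta s d (\<Union>n. A n) \<le> (\<Sum>n. hausdorff_delta s d (A n))"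
    by (rule hausdorff_delta_Union)
  also have "\<dots> \<le> (\<Sum>n. hausdorff_outer s (A n))"
    unfolding hausdorff_outer_def using d by (intro suminf_le summableI SUP_upper)
  finally show "hausdorff_delta s d (\<Union>n. A n) \<le> (\<Sum>n. hausdorff_outer s (A n))" .
qed

lemma hausdorff_outer_space:
  "outer_measure_space UNIV (hausdorff_outer s :: 'a::metric_space set \<Rightarrow> ennreal)"
  by (simp add: outer_measure_space_def positive_def increasing_def hausdorff_outer_mono
      countably_subadditive_def hausdorff_outer_Union)

lemma hausdorff_outer_Un: "hausdorff_outer s (A \<union> B) \<le> hausdorff_outer s A + hausdorff_outer s B"
proof -
  define F where "F i = (if i = 0 then A else if i = (1::nat) then B else {})" for i
  have "A \<union> B = (\<Union>i. F i)" by (auto simp: F_def split: if_splits)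
  moreover have "(\<Sum>i. hausdorff_outer s (F i)) = (\<Sum>i\<in>{0,1}. hausdorff_outer s (F i))"
    by (rule suminf_finite) (auto simp: F_def)
  ultimately show ?thesis using hausdorff_outer_Union[of s F] by (simp add: F_def)
qed

lemma hausdorff_outer_shells:
  fixes T F :: "'a::metric_space set" and a :: "nat \<Rightarrow> real"
  assumes a: "\<And>k. 0 < a k" "\<And>k. a (Suc k) < a k"
  defines "R \<equiv> \<lambda>k. {x \<in> T. a (Suc k) \<le> infdist x F \<and> infdist x F < a (k::nat)}"
  shows "(\<Sum>k<N. hausdorff_outer s (R (2 * k + j))) \<le> hausdorff_outer s (\<Union>k<N. R (2 * k + j))"
proof (induction N)
  case (Suc N)
  let ?U = "\<Union>k<N. R (2 * k + j)"
  have dec: "a n \<le> a m" if "m \<le> n" for m n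
    by (rule lift_Suc_antimono_le[of a, OF less_imp_le[OF a(2)] that])
  have step: "hausdorff_outer s ?U + hausdorff_outer s (R (2 * N + j))
      \<le> hausdorff_outer s (?U \<union> R (2 * N + j))"
  proof (cases "N = 0")
    case False
    show ?thesis
    proof (rule hausdorff_outer_metric)
      show "0 < a (2 * N + j - 1) - a (2 * N + j)"
        using a(2)[of "2 * N + j - 1"] False by simp
      fix x y assume "x \<in> ?U" "y \<in> R (2 * N + j)"
      then obtain k where k: "k < N" "a (Suc (2 * k + j)) \<le> infdist x F"
          and y: "infdist y F < a (2 * N + j)"
        by (auto simp: R_def)
      have "a (2 * N + j - 1) \<le> a (Suc (2 * k + j))" using k by (intro dec) simp
      moreover have "infdist x F \<le> infdist y F + dist x y" by (rule infdist_triangle)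
      ultimately show "a (2 * N + j - 1) - a (2 * N + j) \<le> dist x y" using k y by linarith
    qed
  qed simp
  have "(\<Union>k<Suc N. R (2 * k + j)) = ?U \<union> R (2 * N + j)" by (auto simp: lessThan_Suc)
  then show ?case using order_trans[OF add_right_mono[OF Suc.IH] step] by simp
qed simp

lemma closed_lambda_system_hausdorff:
  fixes F :: "'a::metric_space set"
  assumes F: "closed F"
  shows "F \<in> lambda_system UNIV UNIV (hausdorff_outer s)"
proof -
  have le: "hausdorff_outer s (T \<inter> F) + hausdorff_outer s (T - F) \<le> hausdorff_outer s T" for T
  proof (cases "F = {} \<or> hausdorff_outer s T = \<infinity>")
    case False
    then have ne: "F \<noteq> {}" and fin: "hausdorff_outer s T < \<infinity>" by (auto simp: less_top)
    define a where "a k = inverse (real (Suc k))" for k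
    have a: "0 < a k" "a (Suc k) < a k" for k by (auto simp: a_def field_simps)
    have a0: "a \<longlonglongrightarrow> 0" unfolding a_def by (rule LIMSEQ_inverse_real_of_nat)
    define R where "R k = {x \<in> T. a (Suc k) \<le> infdist x F \<and> infdist x F < a k}" for k
    define G where "G n = {x \<in> T. a n \<le> infdist x F}" for n
    have tail: "T - F \<subseteq> G n \<union> (\<Union>k. R (k + n))" for n
    proof
      fix x assume x: "x \<in> T - F"
      then have pos: "0 < infdist x F"
        using in_closed_iff_infdist_zero[OF F ne] infdist_nonneg[of x F] by fastforce
      show "x \<in> G n \<union> (\<Union>k. R (k + n))"
      proof (cases "a n \<le> infdist x F")
        case False
        obtain m where m: "a m \<le> infdist x F"
          using order_tendstoD(2)[OF a0 pos] by (meson eventually_sequentially less_imp_le order_refl)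
        define k where "k = (LEAST k. a k \<le> infdist x F)"
        have k: "a k \<le> infdist x F" unfolding k_def using m by (rule LeastI)
        have kn: "n < k"
        proof (rule ccontr)
          assume "\<not> n < k"
          then have "a n \<le> a k" by (simp add: a_def field_simps)
          with k False show False by simp
        qed
        then obtain k' where k': "k = Suc k'" by (cases k) auto
        have "\<not> a k' \<le> infdist x F" using not_less_Least[of k' "\<lambda>k. a k \<le> infdist x F"] k'
          by (simp add: k_def)
        then have "x \<in> R (k' - n + n)" using k k' kn x by (simp add: R_def)
        then show ?thesis by blast
      qed (use x in \<open>auto simp: G_def\<close>)
    qed
    have par: "(\<Sum>k<N. hausdorff_outer s (R (2 * k + j))) \<le> hausdorff_outer s T" for N j
    proof -
      have "(\<Sum>k<N. hausdorff_outer s (R (2 * k + j))) \<le> hausdorff_outer s (\<Union>k<N. R (2 * k + j))"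
        unfolding R_def by (rule hausdorff_outer_shells) (rule a)+
      also have "\<dots> \<le> hausdorff_outer s T" by (rule hausdorff_outer_mono) (auto simp: R_def)
      finally show ?thesis .
    qed
    have sum_le: "(\<Sum>k<N. hausdorff_outer s (R k)) \<le> 2 * hausdorff_outer s T" for N
    proof -
      have "(\<Sum>k<N. hausdorff_outer s (R k)) \<le> (\<Sum>k<2 * N. hausdorff_outer s (R k))"
        by (rule sum_mono2) auto
      also have "\<dots> = (\<Sum>k<N. hausdorff_outer s (R (2 * k + 0)))
          + (\<Sum>k<N. hausdorff_outer s (R (2 * k + 1)))"
        by (induction N) (simp_all add: ac_simps)
      also have "\<dots> \<le> hausdorff_outer s T + hausdorff_outer s T" by (intro add_mono par)
      finally show ?thesis by (simp add: mult_2)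
    qed
    have sfin: "(\<Sum>k. hausdorff_outer s (R k)) < \<infinity>"
    proof -
      have "(\<Sum>k. hausdorff_outer s (R k)) \<le> 2 * hausdorff_outer s T"
        unfolding suminf_eq_SUP by (rule SUP_least) (rule sum_le)
      also have "\<dots> < \<infinity>" using fin by (simp add: ennreal_mult_less_top)
      finally show ?thesis .
    qed
    define f where "f k = enn2real (hausdorff_outer s (R k))" for k
    have f: "hausdorff_outer s (R k) = ennreal (f k)" for k
    proof -
      have "hausdorff_outer s (R k) \<le> hausdorff_outer s T"
        by (rule hausdorff_outer_mono) (auto simp: R_def)
      then show ?thesis using fin by (simp add: f_def)
    qed
    have f0: "0 \<le> f k" for k by (simp add: f_def)
    have sf: "summable f"
      using sfin by (intro summable_suminf_not_top f0) (simp add: f)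
    have tl: "(\<Sum>k. hausdorff_outer s (R (k + n))) = ennreal (\<Sum>k. f (k + n))" for n
      unfolding f using sf by (intro suminf_ennreal2 f0) (rule summable_ignore_initial_segment)
    have "(\<lambda>n. hausdorff_outer s T + ennreal (\<Sum>k. f (k + n))) \<longlonglongrightarrow> hausdorff_outer s T + ennreal 0"
      by (intro tendsto_add tendsto_const tendsto_ennrealI suminf_exist_split2 sf)
    moreover have "hausdorff_outer s (T \<inter> F) + hausdorff_outer s (T - F)
        \<le> hausdorff_outer s T + ennreal (\<Sum>k. f (k + n))" for n
    proof -
      have "hausdorff_outer s (T \<inter> F) + hausdorff_outer s (T - F)
         \<le> hausdorff_outer s (T \<inter> F) + (hausdorff_outer s (G n) + hausdorff_outer s (\<Union>k. R (k + n)))"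
        using hausdorff_outer_mono[OF tail[of n], of s]
          hausdorff_outer_Un[of s "G n" "\<Union>k. R (k + n)"]
        by (intro add_left_mono) (rule order_trans)
      also have "\<dots> = (hausdorff_outer s (T \<inter> F) + hausdorff_outer s (G n))
          + hausdorff_outer s (\<Union>k. R (k + n))"
        by (simp add: add.assoc)
      also have "\<dots> \<le> hausdorff_outer s (T \<inter> F \<union> G n) + (\<Sum>k. hausdorff_outer s (R (k + n)))"
      proof (intro add_mono hausdorff_outer_Union hausdorff_outer_metric[OF a(1)[of n]])
        fix x y assume x: "x \<in> T \<inter> F" and "y \<in> G n"
        then have "a n \<le> infdist y F" by (simp add: G_def)
        also have "\<dots> \<le> dist y x" using x by (intro infdist_le) simp
        finally show "a n \<le> dist x y" by (simp add: dist_commute)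
      qed
      also have "\<dots> \<le> hausdorff_outer s T + (\<Sum>k. hausdorff_outer s (R (k + n)))"
        by (intro add_right_mono hausdorff_outer_mono) (auto simp: G_def)
      finally show ?thesis by (simp add: tl)
    qed
    ultimately show ?thesis by (intro LIMSEQ_le_const[where X = "\<lambda>n. hausdorff_outer s T + ennreal (\<Sum>k. f (k + n))"]) auto
  qed auto
  have "hausdorff_outer s (F \<inter> T) + hausdorff_outer s ((UNIV - F) \<inter> T) = hausdorff_outer s T" for T
  proof (rule antisym)
    show "hausdorff_outer s (F \<inter> T) + hausdorff_outer s ((UNIV - F) \<inter> T) \<le> hausdorff_outer s T"
    proof -
      have "F \<inter> T = T \<inter> F" "(UNIV - F) \<inter> T = T - F" by auto
      then show ?thesis using le[of T] by simp
    qed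
    have eq: "F \<inter> T \<union> (UNIV - F) \<inter> T = T" by auto
    show "hausdorff_outer s T \<le> hausdorff_outer s (F \<inter> T) + hausdorff_outer s ((UNIV - F) \<inter> T)"
      using hausdorff_outer_Un[of s "F \<inter> T" "(UNIV - F) \<inter> T"] unfolding eq .
  qed
  then show ?thesis by (simp add: lambda_system_def)
qed

lemma sets_hausdorff_measure [simp]: "sets (hausdorff_measure s) = sets borel"
  unfolding hausdorff_measure_def
  using sets.sigma_sets_eq[of borel] by (simp add: sets_measure_of)

lemma space_hausdorff_measure [simp]: "space (hausdorff_measure s) = UNIV"
  unfolding hausdorff_measure_def by (simp add: space_measure_of)

lemma emeasure_hausdorff_measure:
  fixes A :: "'a::metric_space set"
  assumes "A \<in> sets borel"
  shows "emeasure (hausdorff_measure s) A = hausdorff_outer s A"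
proof -
  let ?L = "lambda_system UNIV UNIV (hausdorff_outer s :: 'a set \<Rightarrow> ennreal)"
  interpret U: sigma_algebra "UNIV :: 'a set" "UNIV :: 'a set set"
    using sigma_algebra_Pow[of "UNIV :: 'a set"] by simp
  have L: "measure_space UNIV ?L (hausdorff_outer s)"
    by (rule U.caratheodory_lemma[OF hausdorff_outer_space])
  then interpret L: sigma_algebra UNIV ?L by (simp add: measure_space_def)
  have "sets (borel :: 'a measure) = sigma_sets UNIV (Collect closed)"
    by (subst borel_eq_closed) (simp add: sets_measure_of)
  also have "\<dots> \<subseteq> ?L"
    using closed_lambda_system_hausdorff by (intro L.sigma_sets_subset) auto
  finally have sub: "sets (borel :: 'a measure) \<subseteq> ?L" .
  show ?thesis
  proof (rule emeasure_measure_of[OF hausdorff_measure_def])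
    show "positive (sets (hausdorff_measure s)) (hausdorff_outer s :: 'a set \<Rightarrow> ennreal)"
      by (simp add: positive_def)
    show "countably_additive (sets (hausdorff_measure s)) (hausdorff_outer s :: 'a set \<Rightarrow> ennreal)"
      using L sub unfolding measure_space_def countably_additive_def sets_hausdorff_measure
      by (meson subset_trans subsetD)
  qed (use assms in auto)
qed

text \<open>Surface measure \<open>ds\<close> on a subset \<open>S\<close> of \<open>(d-1)\<close>-dimensional type.\<close>

definition surface_measure :: "(real^'d) set \<Rightarrow> (real^'d) measure" where
  "surface_measure S = restrict_space (hausdorff_measure (CARD('d) - 1)) S"

subsection \<open>Geometry\<close>

text \<open>Local Cartesian coordinates at \<open>p\<close> with vertical unit vector \<open>\<nu>\<close>: a point \<open>x\<close> has the height
  \<open>inner (x - p) \<nu>\<close> above the hyperplane through \<open>p\<close> orthogonal to \<open>\<nu>\<close>, and the horizontal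
  coordinate \<open>horiz \<nu> (x - p)\<close>, a vector orthogonal to \<open>\<nu>\<close>.\<close>

definition horiz :: "real^'d \<Rightarrow> real^'d \<Rightarrow> real^'d" where
  "horiz \<nu> y = y - inner y \<nu> *\<^sub>R \<nu>"

definition cylinder :: "real^'d \<Rightarrow> real^'d \<Rightarrow> real \<Rightarrow> real \<Rightarrow> (real^'d) set" where
  "cylinder p \<nu> r h = {x. norm (horiz \<nu> (x - p)) < r \<and> \<bar>inner (x - p) \<nu>\<bar> < h}"

definition lipschitz_domain :: "(real^'d) set \<Rightarrow> bool" where
  "lipschitz_domain \<Omega> \<longleftrightarrow> open \<Omega> \<and> connected \<Omega> \<and> \<Omega> \<noteq> {} \<and>
     (\<forall>p\<in>frontier \<Omega>. \<exists>\<nu> r h L \<psi>. norm \<nu> = 1 \<and> 0 < r \<and> 0 < h \<and>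
        lipschitz_on L {y. inner y \<nu> = 0} \<psi> \<and>
        \<Omega> \<inter> cylinder p \<nu> r h =
          {x \<in> cylinder p \<nu> r h. inner (x - p) \<nu> < \<psi> (horiz \<nu> (x - p))} \<and>
        frontier \<Omega> \<inter> cylinder p \<nu> r h =
          {x \<in> cylinder p \<nu> r h. inner (x - p) \<nu> = \<psi> (horiz \<nu> (x - p))})"

definition lipschitz_surface :: "(real^'d) set \<Rightarrow> bool" where
  "lipschitz_surface S \<longleftrightarrow> S \<noteq> {} \<and>
     (\<forall>p\<in>S. \<exists>\<nu> r h L \<psi>. norm \<nu> = 1 \<and> 0 < r \<and> 0 < h \<and>
        lipschitz_on L {y. inner y \<nu> = 0} (\<psi> :: real^'d \<Rightarrow> real) \<and>
        S \<inter> cylinder p \<nu> r h =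
          {x \<in> cylinder p \<nu> r h. inner (x - p) \<nu> = \<psi> (horiz \<nu> (x - p))})"

text \<open>The two subdomains are \<open>\<Omega>s 1\<close> and \<open>\<Omega>s 2\<close>. Their common boundary \<open>\<Gamma>\<close> may reach
  \<open>frontier \<Omega>\<close>; it is then a surface with boundary, and only its part inside \<open>\<Omega>\<close> is locally a
  Lipschitz graph over a full disc.\<close>

definition two_subdomains :: "(real^'d) set \<Rightarrow> (nat \<Rightarrow> (real^'d) set) \<Rightarrow> (real^'d) set \<Rightarrow> bool" where
  "two_subdomains \<Omega> \<Omega>s \<Gamma> \<longleftrightarrow>
     bounded \<Omega> \<and> lipschitz_domain \<Omega> \<and> lipschitz_domain (\<Omega>s 1) \<and> lipschitz_domain (\<Omega>s 2) \<and>
     \<Omega>s 1 \<inter> \<Omega>s 2 = {} \<and> \<Omega> - \<Gamma> = \<Omega>s 1 \<union> \<Omega>s 2 \<and>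
     \<Gamma> = frontier (\<Omega>s 1) \<inter> frontier (\<Omega>s 2) \<and> lipschitz_surface (\<Gamma> \<inter> \<Omega>)"

definition dirichlet_part :: "(real^'d) set \<Rightarrow> (nat \<Rightarrow> (real^'d) set) \<Rightarrow> (real^'d) set \<Rightarrow> bool" where
  "dirichlet_part \<Omega> \<Omega>s D \<longleftrightarrow>
     openin (top_of_set (frontier \<Omega>)) D \<and> D \<subseteq> frontier (\<Omega>s 1) \<and>
     emeasure (hausdorff_measure (CARD('d) - 1)) D > 0"

subsection \<open>Sobolev space and traces\<close>

definition square_integrable :: "'a measure \<Rightarrow> ('a \<Rightarrow> 'b::euclidean_space) \<Rightarrow> bool" where
  "square_integrable N f \<longleftrightarrow> f \<in> borel_measurable N \<and> integrable N (\<lambda>x. (norm (f x))\<^sup>2)"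

definition essentially_bounded :: "'a measure \<Rightarrow> ('a \<Rightarrow> real) \<Rightarrow> bool" where
  "essentially_bounded N f \<longleftrightarrow> f \<in> borel_measurable N \<and> (\<exists>B. AE x in N. \<bar>f x\<bar> \<le> B)"

text \<open>Test functions are taken in \<open>C\<^sup>1\<^sub>c\<close>, which by mollification gives the same weak derivatives as
  \<open>C\<^sup>\<infinity>\<^sub>c\<close>; \<open>\<phi>'\<close> is the gradient of \<open>\<phi>\<close>.\<close>

definition test_function ::
  "(real^'d) set \<Rightarrow> (real^'d \<Rightarrow> real) \<Rightarrow> (real^'d \<Rightarrow> real^'d) \<Rightarrow> bool" where
  "test_function \<Omega> \<phi> \<phi>' \<longleftrightarrow>
     (\<forall>x. (\<phi> has_derivative (\<lambda>h. inner (\<phi>' x) h)) (at x)) \<and> continuous_on UNIV \<phi>' \<and>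
     (\<exists>K. compact K \<and> K \<subseteq> \<Omega> \<and> (\<forall>x. x \<notin> K \<longrightarrow> \<phi> x = 0))"

text \<open>Gradients of vector fields are Jacobians: \<open>G x $ k $ j\<close> is the derivative of the \<open>k\<close>-th
  component in direction \<open>j\<close>. The norm of \<open>real^'d^'d\<close> is the Frobenius norm.\<close>

definition weak_gradient ::
  "(real^'d) set \<Rightarrow> (real^'d \<Rightarrow> real^'d) \<Rightarrow> (real^'d \<Rightarrow> real^'d^'d) \<Rightarrow> bool" where
  "weak_gradient \<Omega> u G \<longleftrightarrow> square_integrable (lebesgue_on \<Omega>) G \<and>
     (\<forall>\<phi> \<phi>' k j. test_function \<Omega> \<phi> \<phi>' \<longrightarrow>
        (\<integral>x. u x $ k * \<phi>' x $ j \<partial>lebesgue_on \<Omega>) = - (\<integral>x. G x $ k $ j * \<phi> x \<partial>lebesgue_on \<Omega>))"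

definition H1 :: "(real^'d) set \<Rightarrow> (real^'d \<Rightarrow> real^'d) set" where
  "H1 \<Omega> = {u. square_integrable (lebesgue_on \<Omega>) u \<and> (\<exists>G. weak_gradient \<Omega> u G)}"

text \<open>Unique up to null sets for \<open>u \<in> H1 \<Omega>\<close>.\<close>

definition grad :: "(real^'d) set \<Rightarrow> (real^'d \<Rightarrow> real^'d) \<Rightarrow> real^'d \<Rightarrow> real^'d^'d" where
  "grad \<Omega> u = (SOME G. weak_gradient \<Omega> u G)"

definition C1_field :: "(real^'d \<Rightarrow> real^'d) \<Rightarrow> (real^'d \<Rightarrow> real^'d^'d) \<Rightarrow> bool" where
  "C1_field w W \<longleftrightarrow>
     (\<forall>x. (w has_derivative (\<lambda>h. W x *v h)) (at x)) \<and> continuous_on UNIV W"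

text \<open>The trace operator is the continuous extension of \<open>w \<mapsto> w\<close> restricted to the boundary, from
  functions that are \<open>C\<^sup>1\<close> up to the boundary to all of \<open>H\<^sup>1\<close>: \<open>g\<close> is the trace of \<open>u\<close> iff some
  such functions \<open>w n\<close> converge to \<open>u\<close> in \<open>H\<^sup>1(\<Omega>)\<close> and to \<open>g\<close> in \<open>L\<^sup>2(\<partial>\<Omega>)\<close>.\<close>

definition has_trace ::
  "(real^'d) set \<Rightarrow> (real^'d \<Rightarrow> real^'d) \<Rightarrow> (real^'d \<Rightarrow> real^'d) \<Rightarrow> bool" where
  "has_trace \<Omega> u g \<longleftrightarrow> square_integrable (surface_measure (frontier \<Omega>)) g \<and>
     (\<exists>w W. (\<forall>n::nat. C1_field (w n) (W n)) \<and>
        (\<lambda>n. \<integral>\<^sup>+x. ennreal ((norm (w n x - u x))\<^sup>2) \<partial>lebesgue_on \<Omega>) \<longlonglongrightarrow> 0 \<and>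
        (\<lambda>n. \<integral>\<^sup>+x. ennreal ((norm (W n x - grad \<Omega> u x))\<^sup>2) \<partial>lebesgue_on \<Omega>) \<longlonglongrightarrow> 0 \<and>
        (\<lambda>n. \<integral>\<^sup>+x. ennreal ((norm (w n x - g x))\<^sup>2) \<partial>surface_measure (frontier \<Omega>))
          \<longlonglongrightarrow> 0)"

text \<open>By the trace theorem every \<open>u \<in> H1 \<Omega>\<close> on a bounded Lipschitz domain has a trace, unique up to
  null sets.\<close>

definition trace_of :: "(real^'d) set \<Rightarrow> (real^'d \<Rightarrow> real^'d) \<Rightarrow> real^'d \<Rightarrow> real^'d" where
  "trace_of \<Omega> u = (SOME g. has_trace \<Omega> u g)"

definition V_space :: "(real^'d) set \<Rightarrow> (real^'d) set \<Rightarrow> (real^'d \<Rightarrow> real^'d) set" where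
  "V_space \<Omega> D =
     {u \<in> H1 \<Omega>. AE x in surface_measure (D \<inter> frontier \<Omega>). trace_of \<Omega> u x = 0}"

subsection \<open>Bilinear forms\<close>

type_synonym 'd tensor4 = "'d \<Rightarrow> 'd \<Rightarrow> 'd \<Rightarrow> 'd \<Rightarrow> real^'d \<Rightarrow> real"

definition elasticity_tensor :: "(real^'d) set \<Rightarrow> 'd tensor4 \<Rightarrow> real \<Rightarrow> bool" where
  "elasticity_tensor \<Omega> c c_star \<longleftrightarrow>
     (\<forall>k l m n. essentially_bounded (lebesgue_on \<Omega>) (c k l m n)) \<and>
     (AE x in lebesgue_on \<Omega>. \<forall>k l m n. c k l m n x = c m n k l x \<and> c k l m n x = c l k m n x) \<and>
     0 < c_star \<and>
     (AE x in lebesgue_on \<Omega>. \<forall>\<xi> :: real^'d^'d. transpose \<xi> = \<xi> \<longrightarrow>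
        c_star * (norm \<xi>)\<^sup>2
          \<le> (\<Sum>k\<in>UNIV. \<Sum>l\<in>UNIV. \<Sum>m\<in>UNIV. \<Sum>n\<in>UNIV. c k l m n x * \<xi> $ k $ l * \<xi> $ m $ n))"

definition strain :: "(real^'d) set \<Rightarrow> (real^'d \<Rightarrow> real^'d) \<Rightarrow> real^'d \<Rightarrow> real^'d^'d" where
  "strain \<Omega> u x = (1/2) *\<^sub>R (grad \<Omega> u x + transpose (grad \<Omega> u x))"

definition stress ::
  "'d tensor4 \<Rightarrow> (real^'d) set \<Rightarrow> (real^'d \<Rightarrow> real^'d) \<Rightarrow> real^'d \<Rightarrow> real^'d^'d" where
  "stress c \<Omega> u x =
     (\<chi> k l. \<Sum>m\<in>UNIV. \<Sum>n\<in>UNIV. c k l m n x * strain \<Omega> u x $ m $ n)"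

definition a_form ::
  "'d tensor4 \<Rightarrow> (real^'d) set \<Rightarrow> (real^'d \<Rightarrow> real^'d) \<Rightarrow> (real^'d \<Rightarrow> real^'d) \<Rightarrow> real" where
  "a_form c \<Omega> u v =
     (\<integral>x. (\<Sum>k\<in>UNIV. \<Sum>l\<in>UNIV. stress c \<Omega> u x $ k $ l * strain \<Omega> v x $ k $ l) \<partial>lebesgue_on \<Omega>)"

text \<open>\<open>u\<close> is defined on \<open>\<Omega>u\<close> and \<open>v\<close> on \<open>\<Omega>v\<close>; only their traces on \<open>\<Gamma>\<close> enter.\<close>

definition a_interface ::
  "(real^'d \<Rightarrow> real) \<Rightarrow> (real^'d) set \<Rightarrow> (real^'d) set \<Rightarrow> (real^'d) set
    \<Rightarrow> (real^'d \<Rightarrow> real^'d) \<Rightarrow> (real^'d \<Rightarrow> real^'d) \<Rightarrow> real" where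
  "a_interface \<zeta> \<Gamma> \<Omega>u \<Omega>v u v =
     (\<integral>x. \<zeta> x * inner (trace_of \<Omega>u u x) (trace_of \<Omega>v v x) \<partial>surface_measure \<Gamma>)"

definition interface_weight :: "(real^'d) set \<Rightarrow> (real^'d \<Rightarrow> real) \<Rightarrow> bool" where
  "interface_weight \<Gamma> \<zeta> \<longleftrightarrow>
     essentially_bounded (surface_measure \<Gamma>) \<zeta> \<and> (AE x in surface_measure \<Gamma>. 0 < \<zeta> x)"

subsection \<open>Discretisation\<close>

text \<open>A nodal finite element basis on one subdomain, split into \<open>nI\<close> functions that belong to nodes
  off \<open>\<Gamma>\<close> and \<open>nB\<close> functions that belong to nodes on \<open>\<Gamma>\<close>. No particular mesh or element is
  prescribed. Nodal finite element functions are continuous up to the boundary, so their values on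
  \<open>\<Gamma>\<close> are meant pointwise.\<close>

definition nodal_basis ::
  "(real^'d) set \<Rightarrow> (real^'d) set \<Rightarrow> (real^'d) set
    \<Rightarrow> nat \<Rightarrow> (nat \<Rightarrow> real^'d \<Rightarrow> real^'d) \<Rightarrow> nat \<Rightarrow> (nat \<Rightarrow> real^'d \<Rightarrow> real^'d) \<Rightarrow> bool" where
  "nodal_basis \<Omega> D \<Gamma> nI \<phi>I nB \<phi>B \<longleftrightarrow>
     (\<forall>k<nI. \<phi>I k \<in> V_space \<Omega> D \<and> continuous_on (closure \<Omega>) (\<phi>I k)) \<and>
     (\<forall>k<nB. \<phi>B k \<in> V_space \<Omega> D \<and> continuous_on (closure \<Omega>) (\<phi>B k)) \<and>
     (\<forall>a b. (\<forall>x\<in>\<Omega>. (\<Sum>k<nI. a k *\<^sub>R \<phi>I k x) + (\<Sum>k<nB. b k *\<^sub>R \<phi>B k x) = 0)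
        \<longrightarrow> (\<forall>k<nI. a k = 0) \<and> (\<forall>k<nB. b k = 0)) \<and>
     (\<forall>k<nI. \<forall>x\<in>\<Gamma>. \<phi>I k x = 0) \<and>
     (\<forall>b. (\<forall>x\<in>\<Gamma>. (\<Sum>k<nB. b k *\<^sub>R \<phi>B k x) = 0) \<longrightarrow> (\<forall>k<nB. b k = 0))"

text \<open>Rows belong to the test functions \<open>\<phi>\<close>, columns to the trial functions \<open>\<psi>\<close>.\<close>

definition form_matrix ::
  "('f \<Rightarrow> 'f \<Rightarrow> real) \<Rightarrow> nat \<Rightarrow> (nat \<Rightarrow> 'f) \<Rightarrow> nat \<Rightarrow> (nat \<Rightarrow> 'f) \<Rightarrow> real mat" where
  "form_matrix a n \<phi> m \<psi> = Matrix.mat n m (\<lambda>(k, l). a (\<psi> l) (\<phi> k))"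

definition vnorm :: "real vec \<Rightarrow> real" where
  "vnorm v = sqrt (v \<bullet> v)"

definition mnorm :: "real mat \<Rightarrow> real vec \<Rightarrow> real" where
  "mnorm M w = sqrt ((M *\<^sub>v w) \<bullet> w)"

text \<open>In the definitions below \<open>AII\<close>, \<open>AIB\<close>, \<open>ABI\<close>, \<open>ABB\<close> and \<open>nI\<close> are indexed by the number
  (1 or 2) of the subdomain, as are the load vectors and the iterates.\<close>

definition A_full :: "(nat \<Rightarrow> real mat) \<Rightarrow> (nat \<Rightarrow> real mat) \<Rightarrow> (nat \<Rightarrow> real mat) \<Rightarrow> (nat \<Rightarrow> real mat)
    \<Rightarrow> nat \<Rightarrow> real mat" where
  "A_full AII AIB ABI ABB i = four_block_mat (AII i) (AIB i) (ABI i) (ABB i)"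

definition A_tilde :: "(nat \<Rightarrow> real mat) \<Rightarrow> (nat \<Rightarrow> real mat) \<Rightarrow> (nat \<Rightarrow> real mat) \<Rightarrow> (nat \<Rightarrow> real mat)
    \<Rightarrow> real mat \<Rightarrow> nat \<Rightarrow> real mat" where
  "A_tilde AII AIB ABI ABB M i = four_block_mat (AII i) (AIB i) (ABI i) (ABB i + M)"

text \<open>Row and column blocks in the order \<open>(1,I), (1,B), (2,B), (2,I)\<close>.\<close>

definition monolithic_matrix :: "(nat \<Rightarrow> nat) \<Rightarrow> nat
    \<Rightarrow> (nat \<Rightarrow> real mat) \<Rightarrow> (nat \<Rightarrow> real mat) \<Rightarrow> (nat \<Rightarrow> real mat) \<Rightarrow> (nat \<Rightarrow> real mat)
    \<Rightarrow> real mat \<Rightarrow> real mat" where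
  "monolithic_matrix nI nB AII AIB ABI ABB M =
     four_block_mat
       (four_block_mat (AII 1) (AIB 1)
                       (ABI 1) (ABB 1 + M))
       (four_block_mat (0\<^sub>m (nI 1) nB) (0\<^sub>m (nI 1) (nI 2))
                       (- M)          (0\<^sub>m nB (nI 2)))
       (four_block_mat (0\<^sub>m nB (nI 1))     (- M)
                       (0\<^sub>m (nI 2) (nI 1)) (0\<^sub>m (nI 2) nB))
       (four_block_mat (ABB 2 + M) (ABI 2)
                       (AIB 2)     (AII 2))"

definition monolithic_solution :: "(nat \<Rightarrow> nat) \<Rightarrow> nat
    \<Rightarrow> (nat \<Rightarrow> real mat) \<Rightarrow> (nat \<Rightarrow> real mat) \<Rightarrow> (nat \<Rightarrow> real mat) \<Rightarrow> (nat \<Rightarrow> real mat)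
    \<Rightarrow> real mat \<Rightarrow> (nat \<Rightarrow> real vec) \<Rightarrow> (nat \<Rightarrow> real vec)
    \<Rightarrow> (nat \<Rightarrow> real vec) \<Rightarrow> (nat \<Rightarrow> real vec) \<Rightarrow> bool" where
  "monolithic_solution nI nB AII AIB ABI ABB M fI fB uI uB \<longleftrightarrow>
     (\<forall>i\<in>{1,2}. uI i \<in> carrier_vec (nI i) \<and> uB i \<in> carrier_vec nB) \<and>
     monolithic_matrix nI nB AII AIB ABI ABB M *\<^sub>v ((uI 1 @\<^sub>v uB 1) @\<^sub>v (uB 2 @\<^sub>v uI 2))
       = (fI 1 @\<^sub>v fB 1) @\<^sub>v (fB 2 @\<^sub>v fI 2)"

text \<open>\<open>uI i m\<close> and \<open>uB i m\<close> are the iterates for \<open>m \<ge> 1\<close>; of those at \<open>m = 0\<close> only \<open>uB 2 0\<close>, the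
  initial guess, is meaningful.\<close>

definition gauss_seidel_iterates :: "(nat \<Rightarrow> nat) \<Rightarrow> nat
    \<Rightarrow> (nat \<Rightarrow> real mat) \<Rightarrow> (nat \<Rightarrow> real mat) \<Rightarrow> (nat \<Rightarrow> real mat) \<Rightarrow> (nat \<Rightarrow> real mat)
    \<Rightarrow> real mat \<Rightarrow> (nat \<Rightarrow> real vec) \<Rightarrow> (nat \<Rightarrow> real vec)
    \<Rightarrow> (nat \<Rightarrow> nat \<Rightarrow> real vec) \<Rightarrow> (nat \<Rightarrow> nat \<Rightarrow> real vec) \<Rightarrow> bool" where
  "gauss_seidel_iterates nI nB AII AIB ABI ABB M fI fB uI uB \<longleftrightarrow>
     uB 2 0 \<in> carrier_vec nB \<and>
     (\<forall>m\<ge>1.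
        (\<forall>i\<in>{1,2}. uI i m \<in> carrier_vec (nI i) \<and> uB i m \<in> carrier_vec nB) \<and>
        A_tilde AII AIB ABI ABB M 1 *\<^sub>v (uI 1 m @\<^sub>v uB 1 m)
          = fI 1 @\<^sub>v (fB 1 + M *\<^sub>v uB 2 (m - 1)) \<and>
        A_tilde AII AIB ABI ABB M 2 *\<^sub>v (uI 2 m @\<^sub>v uB 2 m)
          = fI 2 @\<^sub>v (fB 2 + M *\<^sub>v uB 1 m))"

end

theory Submission
  imports Defs "Jordan_Normal_Form.Determinant"
begin

text \<open>On the first subdomain the energy identity for the error, the Cauchy--Schwarz inequality for
  \<open>M\<close> and coercivity give \<open>(1 + \<alpha>\<^sub>1 \<beta>\<^sub>1) \<parallel>e\<^sub>1\<parallel>\<^sub>M \<le> \<parallel>e\<^sub>2\<parallel>\<^sub>M\<close>; on the second one, where the matrix is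
  merely positive semidefinite, they still give \<open>\<parallel>e\<^sub>2\<parallel>\<^sub>M \<le> \<parallel>e\<^sub>1\<parallel>\<^sub>M\<close>. The full error there is controlled
  by \<open>e\<^sub>1\<close> as soon as \<open>A_tilde 2\<close> is injective. A vector in its kernel has vanishing interface part,
  and its interior part is a finite element function without strain that vanishes on \<open>\<Gamma>\<close>: an
  infinitesimal rigid motion vanishing on a Lipschitz surface, hence zero.\<close>

subsection \<open>Fields with vanishing weak strain\<close>

text \<open>Rigid motions may lie in the kernel of the second stiffness matrix, so its energy cannot
  be expected to contract. Each sweep therefore gains its one factor \<open>r\<close> from the first
  solve: coercivity contributes \<open>\<alpha>\<^sub>1 * \<beta>\<^sub>1\<close> times the squared
  M-norm, which is added to the squared M-norm already present in the energy identity. The full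
  error on the second subdomain is estimated through the inverse of the local matrix instead, with a
  constant that depends on the matrices only. The injectivity behind that inverse is where analysis
  enters. Basis functions are merely H^1 and continuous up to the boundary, so their strain vanishes
  only in the weak sense. Testing in a single direction h and mollifying gives inner (u x - u z) (x
  - z) = 0 on boxes; from there on the rigid form of u follows by algebra and connectedness.\<close>

definition bump :: "real \<Rightarrow> 'a::real_inner \<Rightarrow> real" where
  "bump e y = (max 0 (e\<^sup>2 - inner y y))\<^sup>2"

definition bump_grad :: "real \<Rightarrow> 'a::real_inner \<Rightarrow> 'a" where
  "bump_grad e y = (- 4 * max 0 (e\<^sup>2 - inner y y)) *\<^sub>R y"

text \<open>Squaring removes the kink of the positive part at 0, where the difference quotient is at
  most |h| in absolute value. This is why \<open>bump\<close> is a square: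
  \<open>test_function\<close> asks for one continuous derivative.\<close>

lemma has_real_derivative_pos_part_square:
  "((\<lambda>s::real. (max 0 s)\<^sup>2) has_real_derivative 2 * max 0 s) (at s)"
proof (cases s "0::real" rule: linorder_cases)
  case less
  have "((\<lambda>s::real. 0) has_real_derivative 0) (at s)" by simp
  then have "((\<lambda>s::real. (max 0 s)\<^sup>2) has_real_derivative 0) (at s)"
    by (rule DERIV_cong_ev[OF refl _ refl, THEN iffD1, rotated])
      (use less in \<open>auto intro!: eventually_mono[OF eventually_nhds_in_open[of "{..<0}"]]\<close>)
  then show ?thesis using less by simp
next
  case greater
  have "((\<lambda>s::real. s\<^sup>2) has_real_derivative 2 * s) (at s)"
    by (auto intro!: derivative_eq_intros)
  then have "((\<lambda>s::real. (max 0 s)\<^sup>2) has_real_derivative 2 * s) (at s)"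
    by (rule DERIV_cong_ev[OF refl _ refl, THEN iffD1, rotated])
      (use greater in \<open>auto intro!: eventually_mono[OF eventually_nhds_in_open[of "{0<..}"]]\<close>)
  then show ?thesis using greater by simp
next
  case equal
  have "((\<lambda>h::real. (max 0 h)\<^sup>2 / h) \<longlongrightarrow> 0) (at 0)"
  proof (rule Lim_null_comparison)
    show "\<forall>\<^sub>F h::real in at 0. norm ((max 0 h)\<^sup>2 / h) \<le> \<bar>h\<bar>"
      by (rule always_eventually) (auto simp: max_def power2_eq_square)
    show "((\<lambda>h::real. \<bar>h\<bar>) \<longlongrightarrow> 0) (at 0)"
      using tendsto_rabs[OF tendsto_ident_at, of "0::real" UNIV] by simp
  qed
  then show ?thesis using equal by (simp add: DERIV_def)
qed

lemma has_derivative_bump: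
  "(bump e has_derivative (\<lambda>h. inner (bump_grad e y) h)) (at y)"
proof -
  have "((\<lambda>y. e\<^sup>2 - inner y y) has_derivative (\<lambda>h. - 2 * inner y h)) (at y)"
    by (auto intro!: derivative_eq_intros simp: inner_commute)
  from has_derivative_compose[OF this
      has_real_derivative_pos_part_square[of "e\<^sup>2 - inner y y",
        unfolded has_field_derivative_def]]
  show ?thesis
    by (simp add: bump_def[abs_def] bump_grad_def mult.assoc mult.left_commute)
qed

lemma continuous_on_bump [continuous_intros]:
  "continuous_on S f \<Longrightarrow> continuous_on S (\<lambda>x. bump e (f x))"
  unfolding bump_def by (intro continuous_intros)

lemma continuous_on_bump_grad [continuous_intros]:
  "continuous_on S f \<Longrightarrow> continuous_on S (\<lambda>x. bump_grad e (f x))"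
  unfolding bump_grad_def by (intro continuous_intros)

lemma bump_support:
  assumes "0 < e" "e \<le> norm y" shows "bump e y = 0" "bump_grad e y = 0"
proof -
  have "e\<^sup>2 \<le> inner y y" using assms by (simp add: power2_norm_eq_inner[symmetric] power_mono)
  then show "bump e y = 0" "bump_grad e y = 0" by (auto simp: bump_def bump_grad_def)
qed

lemma bump_nonneg: "0 \<le> bump e y" by (simp add: bump_def)

lemma bump_minus_commute: "bump e (x - y) = bump e (y - x)"
  by (simp add: bump_def inner_diff inner_commute algebra_simps)

lemma test_function_bump:
  assumes "0 < e" "cball z e \<subseteq> \<Omega>"
  shows "test_function \<Omega> (\<lambda>y. bump e (z - y)) (\<lambda>y. - bump_grad e (z - y))"
  unfolding test_function_def
proof (intro conjI allI)
  fix x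
  have "((\<lambda>y. z - y) has_derivative (\<lambda>h. - h)) (at x)"
    by (auto intro!: derivative_eq_intros)
  from has_derivative_compose[OF this has_derivative_bump]
  show "((\<lambda>y. bump e (z - y)) has_derivative (\<lambda>h. inner (- bump_grad e (z - x)) h)) (at x)"
    by simp
  show "continuous_on UNIV (\<lambda>y. - bump_grad e (z - y))" by (intro continuous_intros)
  show "\<exists>K. compact K \<and> K \<subseteq> \<Omega> \<and> (\<forall>x. x \<notin> K \<longrightarrow> bump e (z - x) = 0)"
    using assms by (intro exI[of _ "cball z e"]) (auto simp: dist_norm intro!: bump_support)
qed

text \<open>The supports lie in the box, so both integrals are whole-space Lebesgue integrals, where
  translation invariance and evenness of the kernel apply. One constant can thus normalise the
  mollification at every such centre.\<close>

lemma integral_bump_translate: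
  fixes x z :: "'a::euclidean_space"
  assumes e: "0 < e" and Q: "cball x e \<subseteq> cbox a b" "cball z e \<subseteq> cbox a b"
  shows "integral (cbox a b) (\<lambda>y. bump e (x - y)) = integral (cbox a b) (\<lambda>y. bump e (z - y))"
proof -
  have eq: "integral (cbox a b) (\<lambda>y. bump e (x - y)) = (\<integral>y. bump e (y::'a) \<partial>lborel)"
    if Q: "cball x e \<subseteq> cbox a b" for x
  proof -
    have supp: "y \<notin> cbox a b \<Longrightarrow> bump e (x - y) = 0" for y
      using Q by (intro bump_support e) (force simp: dist_norm)
    have "integrable lborel (\<lambda>y. indicator (cbox a b) y *\<^sub>R bump e (x - y))"
      by (rule borel_integrable_compact) (auto intro!: continuous_intros)
    also have "(\<lambda>y. indicator (cbox a b) y *\<^sub>R bump e (x - y)) = (\<lambda>y. bump e (x - y))"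
      using supp by (auto simp: indicator_def fun_eq_iff)
    finally have int: "integrable lborel (\<lambda>y. bump e (x - y))" .
    have "integral (cbox a b) (\<lambda>y. bump e (x - y)) = integral UNIV (\<lambda>y. bump e (x - y))"
      using supp by (subst integral_restrict_UNIV[symmetric])
        (auto intro!: arg_cong[where f = "integral UNIV"])
    also have "\<dots> = (\<integral>y. bump e (x - y) \<partial>lborel)"
      using integral_lborel[OF int] by simp
    also have "\<dots> = (\<integral>y. bump e (y - x) \<partial>distr lborel borel ((+) x))"
      by (simp add: lborel_distr_plus bump_minus_commute)
    also have "\<dots> = (\<integral>y. bump e (y::'a) \<partial>lborel)"
      by (subst integral_distr) (auto intro!: borel_measurable_continuous_onI continuous_intros)
    finally show ?thesis .
  qed
  show ?thesis using Q by (simp add: eq)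
qed

text \<open>A continuous nonnegative function with integral 0 vanishes on the box, but at its centre
  \<open>x\<close> the bump equals e^4.\<close>

lemma integral_bump_pos:
  fixes x :: "'a::euclidean_space"
  assumes e: "0 < e" and Q: "cball x e \<subseteq> cbox a b"
  shows "0 < integral (cbox a b) (\<lambda>y. bump e (x - y))"
proof -
  have cont: "continuous_on (cbox a b) (\<lambda>y. bump e (x - y))" by (intro continuous_intros)
  have "0 \<le> integral (cbox a b) (\<lambda>y. bump e (x - y))"
    by (rule integral_nonneg) (auto intro!: integrable_continuous cont bump_nonneg)
  moreover have "integral (cbox a b) (\<lambda>y. bump e (x - y)) \<noteq> 0"
  proof
    assume "integral (cbox a b) (\<lambda>y. bump e (x - y)) = 0"
    then have int0: "((\<lambda>y. bump e (x - y)) has_integral 0) (cbox a b)"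
      using integrable_integral[OF integrable_continuous[OF cont]] by simp
    have "x \<in> interior (cball x e)" using e by simp
    then have "x \<in> interior (cbox a b)" using interior_mono[OF Q] by blast
    then have x: "x \<in> box a b" by (simp add: interior_cbox)
    have "bump e (x - x) = 0"
    proof (rule has_integral_0_cbox_imp_0[OF cont bump_nonneg int0])
      show "box a b \<noteq> {}" "x \<in> cbox a b" using x box_subset_cbox[of a b] by auto
    qed
    then show False using e by (simp add: bump_def)
  qed
  ultimately show ?thesis by linarith
qed

text \<open>Mollified, the hypothesis says that the symmetric gradient of \<open>u\<close> vanishes, so \<open>inner u h\<close> is
  constant along segments in direction \<open>h\<close>.\<close>

lemma weakly_strain_free_inner_diff:
  fixes u :: "real^'d \<Rightarrow> real^'d"
  assumes \<Omega>: "open \<Omega>" and cont: "continuous_on \<Omega> u"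
    and weak: "\<And>\<phi> \<phi>' h. test_function \<Omega> \<phi> \<phi>' \<Longrightarrow>
      (\<integral>x. inner (u x) h * inner (\<phi>' x) h \<partial>lebesgue_on \<Omega>) = 0"
    and Q: "cbox a b \<subseteq> \<Omega>" and x: "x \<in> box a b" and z: "z \<in> box a b"
  shows "inner (u x - u z) (x - z) = 0"
proof -
  define h where "h = x - z"
  define v where "v y = inner (u y) h" for y
  have cu: "continuous_on (cbox a b) u" using cont Q by (rule continuous_on_subset)
  have cv: "continuous_on (cbox a b) v" unfolding v_def by (intro continuous_intros cu)
  have seg: "z + t *\<^sub>R h \<in> closed_segment z x" if "t \<in> {0..1}" for t
    using that by (auto simp: closed_segment_def h_def algebra_simps intro!: exI[of _ t])
  have "closed_segment z x \<subseteq> box a b" using x z by (simp add: closed_segment_subset)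
  \<comment> \<open>Compactness of the segment gives one margin \<open>d\<close> for all its points;
    mollifiers of smaller radius centred there keep their support in the box.\<close>
  then obtain d where d: "0 < d" "(\<Union>y\<in>closed_segment z x. ball y d) \<subseteq> box a b"
    using compact_subset_open_imp_ball_epsilon_subset[OF compact_segment open_box] by metis
  have inQ: "cball (z + t *\<^sub>R h) e \<subseteq> cbox a b" if "t \<in> {0..1}" "e < d" for t e
  proof -
    have "cball (z + t *\<^sub>R h) e \<subseteq> ball (z + t *\<^sub>R h) d" using that by auto
    also have "\<dots> \<subseteq> box a b" using d(2) seg[OF that(1)] by blast
    finally show ?thesis using box_subset_cbox by blast
  qed
  have shift: "integral (cbox a b) (\<lambda>y. v y * bump e (x - y)) =
      integral (cbox a b) (\<lambda>y. v y * bump e (z - y))" if e: "0 < e" "e < d" for e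
  proof -
    \<comment> \<open>The unnormalised mollification of \<open>v\<close> along the segment.
      Differentiation in \<open>t\<close> falls on the kernel, so continuity of \<open>v\<close>
      suffices.\<close>
    define F where "F t = integral (cbox a b) (\<lambda>y. v y * bump e (z + t *\<^sub>R h - y))" for t
    have der: "(F has_derivative (\<lambda>_. 0)) (at t within {0..1})" if t: "t \<in> {0..1}" for t
    proof -
      define s where "s = z + t *\<^sub>R h"
      have "(F has_vector_derivative integral (cbox a b)
          (\<lambda>y. v y * inner (bump_grad e (z + t *\<^sub>R h - y)) h)) (at t within {0..1})"
        unfolding F_def
      proof (rule leibniz_rule_vector_derivative[OF _ _ _ t])
        fix t y assume "y \<in> cbox a b"
        have "((\<lambda>t. z + t *\<^sub>R h - y) has_derivative (\<lambda>r. r *\<^sub>R h)) (at t within {0..1})"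
          by (auto intro!: derivative_eq_intros)
        from has_derivative_compose[OF this has_derivative_bump]
        show "((\<lambda>t. v y * bump e (z + t *\<^sub>R h - y)) has_vector_derivative
            v y * inner (bump_grad e (z + t *\<^sub>R h - y)) h) (at t within {0..1})"
          unfolding has_vector_derivative_def
          by (auto intro!: derivative_eq_intros)
      next
        show "(\<lambda>y. v y * bump e (z + t *\<^sub>R h - y)) integrable_on cbox a b" for t
          by (intro integrable_continuous continuous_intros cv)
        have "continuous_on ({0..1} \<times> cbox a b) (\<lambda>p. v (snd p))"
          by (rule continuous_on_compose2[OF cv]) (auto intro: continuous_intros)
        then show "continuous_on ({0..1} \<times> cbox a b)
            (\<lambda>(t, y). v y * inner (bump_grad e (z + t *\<^sub>R h - y)) h)"
          unfolding split_beta by (intro continuous_intros)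
      qed simp
      \<comment> \<open>Up to sign this is \<open>weak\<close> for the test function
        \<open>bump e (s - y)\<close> and the direction \<open>h\<close>. Its support lies in the
        box, so the integrals over the box and over \<Omega> coincide.\<close>
      moreover have "integral (cbox a b) (\<lambda>y. v y * inner (bump_grad e (s - y)) h) = 0"
      proof -
        let ?g = "\<lambda>y. v y * inner (- bump_grad e (s - y)) h"
        have sQ: "cball s e \<subseteq> cbox a b" unfolding s_def by (rule inQ[OF t e(2)])
        have g0: "?g y = 0" if "y \<notin> cbox a b" for y
          using bump_support(2)[OF e(1), of "s - y"] sQ that by (force simp: dist_norm)
        have ig: "integrable (lebesgue_on (cbox a b)) ?g"
          by (intro continuous_imp_integrable continuous_intros cv)
        have "integral (cbox a b) ?g = (\<integral>y. ?g y \<partial>lebesgue_on (cbox a b))"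
          using lebesgue_integral_eq_integral[OF ig] by simp
        also have "\<dots> = (\<integral>y. indicator (cbox a b) y *\<^sub>R ?g y \<partial>lebesgue)"
          by (subst integral_restrict_space) auto
        also have "\<dots> = (\<integral>y. indicator \<Omega> y *\<^sub>R ?g y \<partial>lebesgue)"
          using g0 Q by (intro Bochner_Integration.integral_cong) (auto simp: indicator_def)
        also have "\<dots> = (\<integral>y. ?g y \<partial>lebesgue_on \<Omega>)"
          using \<Omega> by (subst integral_restrict_space) auto
        also have "\<dots> = 0"
          unfolding v_def by (rule weak[OF test_function_bump[OF e(1)]]) (use sQ Q in auto)
        finally show ?thesis by simp
      qed
      ultimately show ?thesis unfolding s_def has_vector_derivative_def by simp
    qed
    obtain k where "\<forall>t\<in>{0..1}. F t = k"
      using has_derivative_zero_constant[OF _ der] by auto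
    then have "F 1 = F 0" by simp
    then show ?thesis by (simp add: F_def h_def)
  qed
  \<comment> \<open>The mollified values at \<open>x\<close> and \<open>z\<close> agree and, divided
    by the mass of the kernel, differ from \<open>v x\<close> and \<open>v z\<close> by at most
    \<eta>/2 each. The summand 0 matches \<open>field_le_epsilon\<close>.\<close>
  have "\<bar>v x - v z\<bar> \<le> 0 + \<eta>" if \<eta>: "0 < \<eta>" for \<eta>
  proof -
    have osc: "\<exists>r>0. \<forall>y\<in>cbox a b. dist y p < r \<longrightarrow> \<bar>v y - v p\<bar> \<le> \<eta> / 2" if "p \<in> box a b" for p
    proof -
      have "p \<in> cbox a b" "0 < \<eta> / 2" using that \<eta> box_subset_cbox[of a b] by auto
      with cv obtain r where "0 < r" "\<forall>y\<in>cbox a b. dist y p < r \<longrightarrow> dist (v y) (v p) < \<eta> / 2"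
        unfolding continuous_on_iff by blast
      then show ?thesis by (auto simp: dist_real_def less_imp_le intro!: exI[of _ r])
    qed
    obtain r1 r2 where r: "0 < r1" "0 < r2"
      "\<And>y. y \<in> cbox a b \<Longrightarrow> dist y x < r1 \<Longrightarrow> \<bar>v y - v x\<bar> \<le> \<eta> / 2"
      "\<And>y. y \<in> cbox a b \<Longrightarrow> dist y z < r2 \<Longrightarrow> \<bar>v y - v z\<bar> \<le> \<eta> / 2"
      using osc[OF x] osc[OF z] by metis
    \<comment> \<open>Below \<open>d\<close>, so that \<open>shift\<close> applies; at most
      \<open>r1\<close> and \<open>r2\<close>, so that \<open>v\<close> deviates by at most \<eta>/2
      on either support.\<close>
    define e where "e = min (d / 2) (min r1 r2)"
    have e: "0 < e" "e < d" "e \<le> r1" "e \<le> r2" using r d by (auto simp: e_def)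
    have Qx: "cball x e \<subseteq> cbox a b" using inQ[of 1 e] e by (simp add: h_def)
    have Qz: "cball z e \<subseteq> cbox a b" using inQ[of 0 e] e by simp
    define c where "c = integral (cbox a b) (\<lambda>y. bump e (x - y))"
    have c: "0 < c" "c = integral (cbox a b) (\<lambda>y. bump e (z - y))"
      using integral_bump_pos[OF e(1) Qx] integral_bump_translate[OF e(1) Qx Qz] by (auto simp: c_def)
    have near: "\<bar>integral (cbox a b) (\<lambda>y. v y * bump e (p - y)) - v p * c\<bar> \<le> \<eta> / 2 * c"
      if cp: "c = integral (cbox a b) (\<lambda>y. bump e (p - y))"
        and vp: "\<And>y. y \<in> cbox a b \<Longrightarrow> dist y p < e \<Longrightarrow> \<bar>v y - v p\<bar> \<le> \<eta> / 2" for p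
    proof -
      have "integral (cbox a b) (\<lambda>y. v y * bump e (p - y)) - v p * c
          = integral (cbox a b) (\<lambda>y. v y * bump e (p - y) - v p * bump e (p - y))"
        unfolding cp by (subst Henstock_Kurzweil_Integration.integral_diff)
          (auto intro!: integrable_continuous continuous_intros cv)
      also have "norm \<dots> \<le> integral (cbox a b) (\<lambda>y. \<eta> / 2 * bump e (p - y))"
      proof (rule Henstock_Kurzweil_Integration.integral_norm_bound_integral)
        fix y assume y: "y \<in> cbox a b"
        show "norm (v y * bump e (p - y) - v p * bump e (p - y)) \<le> \<eta> / 2 * bump e (p - y)"
        proof (cases "dist y p < e")
          case True
          then show ?thesis
            using mult_right_mono[OF vp[OF y True] bump_nonneg[of e "p - y"]] bump_nonneg[of e "p - y"]
            by (simp add: left_diff_distrib[symmetric] abs_mult)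
        next
          case False
          then show ?thesis using bump_support(1)[OF e(1), of "p - y"]
            by (simp add: dist_norm norm_minus_commute)
        qed
      qed (auto intro!: integrable_continuous continuous_intros cv)
      also have "\<dots> = \<eta> / 2 * c" unfolding cp by simp
      finally show ?thesis by simp
    qed
    have "\<bar>v x * c - v z * c\<bar> \<le> \<eta> * c"
    proof -
      have "\<bar>integral (cbox a b) (\<lambda>y. v y * bump e (x - y)) - v x * c\<bar> \<le> \<eta> / 2 * c"
        using r e by (intro near[OF c_def]) auto
      moreover have "\<bar>integral (cbox a b) (\<lambda>y. v y * bump e (z - y)) - v z * c\<bar> \<le> \<eta> / 2 * c"
        using r e by (intro near[OF c(2)]) auto
      ultimately show ?thesis unfolding shift[OF e(1,2)] by argo
    qed
    then have "\<bar>v x - v z\<bar> * c \<le> \<eta> * c"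
      using c(1) by (simp add: left_diff_distrib[symmetric] abs_mult)
    then show ?thesis using c(1) by simp
  qed
  then have "\<bar>v x - v z\<bar> \<le> 0" by (rule field_le_epsilon)
  then show ?thesis by (simp add: v_def h_def inner_diff_left)
qed

section \<open>Infinitesimal rigid motions\<close>

text \<open>Polarisation: the hypothesis at the three pairs formed from p + x, p + y and p says that
  the increment \<open>g\<close> is skew, inner (g x) y = - inner (g y) x. For fixed y the right
  side is linear in x, hence so is \<open>g\<close>.\<close>

lemma affine_of_inner_diff:
  fixes u :: "real^'d \<Rightarrow> real^'d"
  assumes \<rho>: "0 < \<rho>"
    and orth: "\<And>x y. x \<in> ball p \<rho> \<Longrightarrow> y \<in> ball p \<rho> \<Longrightarrow> inner (u x - u y) (x - y) = 0"
  shows "\<exists>a (W::real^'d^'d). (\<forall>h. inner (W *v h) h = 0) \<and> (\<forall>y\<in>ball p \<rho>. u y = a + W *v y)"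
proof -
  define g where "g h = u (p + h) - u p" for h
  have sk: "inner (g x) y = - inner (g y) x" if "norm x < \<rho>" "norm y < \<rho>" for x y
  proof -
    have 1: "inner (u (p + x) - u (p + y)) ((p + x) - (p + y)) = 0"
      by (rule orth) (use that in \<open>auto simp: dist_norm\<close>)
    have 2: "inner (u (p + x) - u p) ((p + x) - p) = 0"
      by (rule orth) (use that \<rho> in \<open>auto simp: dist_norm\<close>)
    have 3: "inner (u (p + y) - u p) ((p + y) - p) = 0"
      by (rule orth) (use that \<rho> in \<open>auto simp: dist_norm\<close>)
    show ?thesis using 1 2 3 by (simp add: g_def inner_diff inner_add algebra_simps)
  qed
  define s where "s = \<rho> / 2"
  have s: "0 < s" "s < \<rho>" using \<rho> by (auto simp: s_def)
  \<comment> \<open>Row \<open>j\<close> is read off from s (g x)_j = inner (g x) (s e_j) = - inner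
    (g (s e_j)) x; the factor \<open>s\<close> moves the unit vectors into the ball.\<close>
  define W :: "real^'d^'d" where "W = (\<chi> j. (- 1 / s) *\<^sub>R g (s *\<^sub>R axis j 1))"
  have gW: "g x = W *v x" if "norm x < \<rho>" for x
  proof (subst Finite_Cartesian_Product.vec_eq_iff, intro allI)
    fix j
    have "s * (g x $ j) = inner (g x) (s *\<^sub>R axis j 1)" by (simp add: inner_axis)
    also have "\<dots> = - inner (g (s *\<^sub>R axis j 1)) x"
      by (rule sk[OF that]) (use s in \<open>simp add: norm_axis_1\<close>)
    also have "\<dots> = s * ((W *v x) $ j)"
      using s by (simp add: W_def matrix_vector_mult_def inner_vec_def sum_distrib_left sum_negf[symmetric])
    finally show "g x $ j = (W *v x) $ j" using s by simp
  qed
  have skew: "inner (W *v h) h = 0" for h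
  proof (cases "h = 0")
    case False
    define t where "t = s / norm h"
    have t: "0 < t" "norm (t *\<^sub>R h) < \<rho>" using s False by (auto simp: t_def)
    have "inner (W *v (t *\<^sub>R h)) (t *\<^sub>R h) = 0"
      using sk[OF t(2) t(2)] gW[OF t(2)] by simp
    then show ?thesis using t by (simp add: matrix_vector_mult_scaleR)
  qed simp
  have "u y = (u p - W *v p) + W *v y" if "y \<in> ball p \<rho>" for y
    using gW[of "y - p"] that
    by (simp add: g_def dist_norm norm_minus_commute matrix_vector_mult_diff_distrib)
      (simp add: algebra_simps)
  with skew show ?thesis by blast
qed

lemma affine_eq_on_ball:
  fixes W W' :: "real^'d^'d"
  assumes "0 < \<rho>" and eq: "\<And>y. y \<in> ball p \<rho> \<Longrightarrow> a + W *v y = a' + W' *v y"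
  shows "a = a' \<and> W = W'"
proof -
  have Wh: "W *v h = W' *v h" for h
  proof (cases "h = 0")
    case False
    define t where "t = \<rho> / 2 / norm h"
    have t: "0 < t" "norm (t *\<^sub>R h) < \<rho>" using assms False by (auto simp: t_def)
    have "a + W *v (p + t *\<^sub>R h) = a' + W' *v (p + t *\<^sub>R h)"
      by (rule eq) (use t in \<open>simp add: dist_norm\<close>)
    moreover have "a + W *v p = a' + W' *v p" by (rule eq) (use assms in simp)
    ultimately have "(a + W *v (p + t *\<^sub>R h)) - (a + W *v p) =
        (a' + W' *v (p + t *\<^sub>R h)) - (a' + W' *v p)" by simp
    then have "t *\<^sub>R (W *v h) = t *\<^sub>R (W' *v h)"
      by (simp add: matrix_vector_right_distrib matrix_vector_mult_scaleR)
    then show ?thesis using t by simp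
  qed simp
  then have "W = W'" by (simp add: matrix_eq)
  then show ?thesis using eq[of p] assms by simp
qed

text \<open>The set \<open>T\<close> of points near which \<open>u\<close> agrees with one fixed
  affine map is open. A point of \<Omega> outside \<open>T\<close> has a ball with its own affine
  map, which would coincide with the fixed one as soon as the ball met \<open>T\<close>; so the
  complement is open too, and connectedness decides. \<open>P\<close> survives because the global
  matrix is one of the local ones.\<close>

lemma locally_affine_imp_affine:
  fixes u :: "real^'d \<Rightarrow> real^'d"
  assumes \<Omega>: "open \<Omega>" "connected \<Omega>" "\<Omega> \<noteq> {}"
    and loc: "\<And>p. p \<in> \<Omega> \<Longrightarrow> \<exists>\<rho>>0. ball p \<rho> \<subseteq> \<Omega> \<and>
      (\<exists>a (W::real^'d^'d). P W \<and> (\<forall>y\<in>ball p \<rho>. u y = a + W *v y))"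
  shows "\<exists>a W. P W \<and> (\<forall>y\<in>\<Omega>. u y = a + W *v y)"
proof -
  obtain p where p: "p \<in> \<Omega>" using \<Omega> by blast
  obtain \<rho> a and W :: "real^'d^'d" where 1: "0 < \<rho>" "P W" "\<forall>y\<in>ball p \<rho>. u y = a + W *v y"
    using loc[OF p] by blast
  define T where "T = {x \<in> \<Omega>. \<exists>e>0. \<forall>y\<in>ball x e. u y = a + W *v y}"
  have T\<Omega>: "T \<subseteq> \<Omega>" by (auto simp: T_def)
  have opT: "open T"
    unfolding open_contains_ball
  proof
    fix x assume x: "x \<in> T"
    then obtain e where e: "0 < e" "\<forall>y\<in>ball x e. u y = a + W *v y" by (auto simp: T_def)
    obtain d where d: "0 < d" "ball x d \<subseteq> \<Omega>" using \<Omega>(1) x T\<Omega> unfolding open_contains_ball by blast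
    have "ball x (min d e) \<subseteq> T"
    proof
      fix y assume y: "y \<in> ball x (min d e)"
      have "open (ball x e)" by simp
      then obtain k where "0 < k" "ball y k \<subseteq> ball x e"
        using y unfolding open_contains_ball by (metis ball_min_Int Int_iff)
      then show "y \<in> T" using y e d by (auto simp: T_def intro!: exI[of _ k])
    qed
    then show "\<exists>e>0. ball x e \<subseteq> T" using d e by (intro exI[of _ "min d e"]) auto
  qed
  have opD: "open (\<Omega> - T)"
    unfolding open_contains_ball
  proof
    fix x assume x: "x \<in> \<Omega> - T"
    then obtain e b and V :: "real^'d^'d" where e: "0 < e" "ball x e \<subseteq> \<Omega>" "\<forall>y\<in>ball x e. u y = b + V *v y"
      using loc[of x] by blast
    have "ball x e \<inter> T = {}"
    proof (rule ccontr)
      assume "ball x e \<inter> T \<noteq> {}"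
      then obtain y d where y: "y \<in> ball x e" "0 < d" "\<forall>w\<in>ball y d. u w = a + W *v w"
        by (auto simp: T_def)
      obtain k where k: "0 < k" "ball y k \<subseteq> ball x e"
        using y(1) open_ball[of x e] unfolding open_contains_ball by blast
      have "a = b \<and> W = V"
      proof (rule affine_eq_on_ball[of "min k d" y])
        fix w assume "w \<in> ball y (min k d)"
        then have "w \<in> ball y d" "w \<in> ball x e" using k by auto
        then show "a + W *v w = b + V *v w" using y e by metis
      qed (use k y in simp)
      then show False using e x by (auto simp: T_def)
    qed
    then show "\<exists>e>0. ball x e \<subseteq> \<Omega> - T" using e by blast
  qed
  have "T \<inter> \<Omega> = {} \<or> (\<Omega> - T) \<inter> \<Omega> = {}"
    using connectedD[OF \<Omega>(2) opT opD] by blast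
  moreover have "p \<in> T" using p 1 by (auto simp: T_def)
  ultimately have "\<Omega> \<subseteq> T" using p by blast
  then have "u y = a + W *v y" if "y \<in> \<Omega>" for y using that by (force simp: T_def)
  with 1(2) show ?thesis by blast
qed

lemma skew_inner_commute:
  fixes W :: "real^'d^'d"
  assumes "\<And>h. inner (W *v h) h = 0"
  shows "inner (W *v x) y = - inner (W *v y) x"
  using assms[of "x + y"] assms[of x] assms[of y]
  by (simp add: matrix_vector_right_distrib inner_add algebra_simps)

text \<open>The zeros of a nonzero infinitesimal rigid motion lie in an affine subspace of codimension at
  least 2, which cannot contain a Lipschitz graph: on the graph \<open>W y = - \<psi> y (W \<nu>)\<close> for horizontal
  \<open>y\<close>, and choosing \<open>y\<close> parallel to \<open>W \<nu>\<close> forces \<open>W \<nu> = 0\<close>.\<close>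

lemma rigid_zero_on_lipschitz_surface:
  fixes W :: "real^'d^'d"
  assumes S: "lipschitz_surface S" and skew: "\<And>h. inner (W *v h) h = 0"
    and zero: "\<And>x. x \<in> S \<Longrightarrow> a + W *v x = 0"
  shows "a + W *v x = 0"
proof -
  obtain p where p: "p \<in> S" using S by (auto simp: lipschitz_surface_def)
  obtain \<nu> r h L and \<psi> :: "real^'d \<Rightarrow> real" where
    \<nu>: "norm \<nu> = 1" and r: "0 < r" and h: "0 < h"
    and lip: "lipschitz_on L {y. inner y \<nu> = 0} \<psi>"
    and loc: "S \<inter> cylinder p \<nu> r h =
          {x \<in> cylinder p \<nu> r h. inner (x - p) \<nu> = \<psi> (horiz \<nu> (x - p))}"
    using S p unfolding lipschitz_surface_def by blast
  have \<nu>\<nu>: "inner \<nu> \<nu> = 1" using \<nu> by (simp add: norm_eq_1)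
  have "p \<in> S \<inter> cylinder p \<nu> r h" using p r h by (simp add: cylinder_def horiz_def)
  then have "inner (p - p) \<nu> = \<psi> (horiz \<nu> (p - p))" unfolding loc by blast
  then have \<psi>0: "\<psi> 0 = 0" by (simp add: horiz_def)
  have L0: "0 \<le> L" using lip by (rule lipschitz_on_nonneg)
  \<comment> \<open>Keeps the graph point over \<open>y\<close> inside the cylinder:
    \<open>r\<close> limits the horizontal part, the Lipschitz bound limits the height, and
    \<open>L + 1\<close> avoids a division by 0.\<close>
  define \<delta> where "\<delta> = min r (h / (L + 1))"
  have \<delta>: "0 < \<delta>" using r h L0 by (simp add: \<delta>_def)
  have graph: "W *v y + \<psi> y *\<^sub>R (W *v \<nu>) = 0" if y: "inner y \<nu> = 0" "norm y < \<delta>" for y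
  proof -
    have "\<bar>\<psi> y\<bar> \<le> L * norm y"
      using lipschitz_onD[OF lip, of y 0] y \<psi>0 by (simp add: dist_norm)
    also have "\<dots> \<le> (L + 1) * norm y" by (simp add: algebra_simps)
    also have "\<dots> < h" using y(2) L0 by (simp add: \<delta>_def field_simps)
    finally have \<psi>h: "\<bar>\<psi> y\<bar> < h" .
    let ?x = "p + (y + \<psi> y *\<^sub>R \<nu>)"
    have "horiz \<nu> (?x - p) = y" using y \<nu>\<nu> by (simp add: horiz_def inner_add)
    moreover have "inner (?x - p) \<nu> = \<psi> y" using y \<nu>\<nu> by (simp add: inner_add)
    ultimately have "?x \<in> {x \<in> cylinder p \<nu> r h. inner (x - p) \<nu> = \<psi> (horiz \<nu> (x - p))}"
      using y \<psi>h by (simp add: cylinder_def \<delta>_def)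
    then have "?x \<in> S" unfolding loc[symmetric] by blast
    \<comment> \<open>Both \<open>p\<close> and the graph point are zeros of the rigid motion;
      subtraction removes \<open>a\<close>.\<close>
    have "W *v y + \<psi> y *\<^sub>R (W *v \<nu>) = (a + W *v ?x) - (a + W *v p)"
      by (simp add: matrix_vector_right_distrib matrix_vector_mult_scaleR)
    then show ?thesis using zero[OF \<open>?x \<in> S\<close>] zero[OF p] by simp
  qed
  define b where "b = W *v \<nu>"
  have b\<nu>: "inner b \<nu> = 0" unfolding b_def by (rule skew)
  have b0: "b = 0"
  proof (rule ccontr)
    assume b: "b \<noteq> 0"
    define y where "y = (\<delta> / 2 / norm b) *\<^sub>R b"
    have y: "inner y \<nu> = 0" "norm y < \<delta>" using b\<nu> b \<delta> by (auto simp: y_def)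
    \<comment> \<open>Pairing with \<open>y\<close> removes \<open>W *v y\<close> by skewness and
      leaves \<open>\<psi> y * inner b y = 0\<close> with a positive second factor. Hence
      \<open>W *v b = 0\<close>, and skewness turns inner b b into - inner (W b) \<nu> = 0.\<close>
    have "inner (W *v y + \<psi> y *\<^sub>R b) y = 0" using graph[OF y] by (simp add: b_def)
    then have "\<psi> y * inner b y = 0" using skew[of y] by (simp add: inner_add)
    then have "\<psi> y = 0" using b \<delta> by (simp add: y_def)
    then have "W *v y = 0" using graph[OF y] by simp
    then have "W *v b = 0" using b \<delta> by (simp add: y_def matrix_vector_mult_scaleR)
    then have "inner b b = 0" using skew_inner_commute[OF skew, of \<nu> b] by (simp add: b_def)
    then show False using b by simp
  qed
  have Wh: "W *v y = 0" if "inner y \<nu> = 0" for y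
  proof (cases "y = 0")
    case False
    define t where "t = \<delta> / 2 / norm y"
    have t: "0 < t" "norm (t *\<^sub>R y) < \<delta>" using \<delta> False by (auto simp: t_def)
    have "W *v (t *\<^sub>R y) = 0" using graph[of "t *\<^sub>R y"] t that b0 by (simp add: b_def)
    then show ?thesis using t by (simp add: matrix_vector_mult_scaleR)
  qed simp
  have W0: "W *v y = 0" for y
  proof -
    have "W *v y = W *v horiz \<nu> y + inner y \<nu> *\<^sub>R b"
      by (simp add: horiz_def b_def matrix_vector_mult_diff_distrib matrix_vector_mult_scaleR)
    also have "\<dots> = 0" using Wh[of "horiz \<nu> y"] b0 \<nu>\<nu> by (simp add: horiz_def inner_diff)
    finally show ?thesis .
  qed
  then show ?thesis using zero[OF p] by simp
qed

lemma weakly_strain_free_imp_rigid: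
  fixes u :: "real^'d \<Rightarrow> real^'d"
  assumes \<Omega>: "open \<Omega>" "connected \<Omega>" "\<Omega> \<noteq> {}" and cont: "continuous_on \<Omega> u"
    and weak: "\<And>\<phi> \<phi>' h. test_function \<Omega> \<phi> \<phi>' \<Longrightarrow>
      (\<integral>x. inner (u x) h * inner (\<phi>' x) h \<partial>lebesgue_on \<Omega>) = 0"
  shows "\<exists>a (W::real^'d^'d). (\<forall>h. inner (W *v h) h = 0) \<and> (\<forall>y\<in>\<Omega>. u y = a + W *v y)"
proof (rule locally_affine_imp_affine[OF \<Omega>])
  fix p assume "p \<in> \<Omega>"
  then obtain a b where ab: "p \<in> box a b" "cbox a b \<subseteq> \<Omega>"
    using open_contains_cbox[OF \<Omega>(1)] by metis
  then obtain \<rho> where \<rho>: "0 < \<rho>" "ball p \<rho> \<subseteq> box a b"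
    using open_box[of a b] unfolding open_contains_ball by blast
  have "\<exists>a (W::real^'d^'d). (\<forall>h. inner (W *v h) h = 0) \<and> (\<forall>y\<in>ball p \<rho>. u y = a + W *v y)"
    using \<rho> by (intro affine_of_inner_diff weakly_strain_free_inner_diff[OF \<Omega>(1) cont weak ab(2)]) auto
  then show "\<exists>\<rho>>0. ball p \<rho> \<subseteq> \<Omega> \<and>
      (\<exists>a (W::real^'d^'d). (\<forall>h. inner (W *v h) h = 0) \<and> (\<forall>y\<in>ball p \<rho>. u y = a + W *v y))"
    using \<rho> ab(2) box_subset_cbox[of a b] by (intro exI[of _ \<rho>]) blast
qed

text \<open>\<open>S\<close> may lie on the boundary of \<Omega>, where the rigid representation is
  not given directly; continuity on the closure carries it there.\<close>

lemma weakly_strain_free_zero_on_surface: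
  fixes u :: "real^'d \<Rightarrow> real^'d"
  assumes \<Omega>: "open \<Omega>" "connected \<Omega>" "\<Omega> \<noteq> {}" and cont: "continuous_on (closure \<Omega>) u"
    and weak: "\<And>\<phi> \<phi>' h. test_function \<Omega> \<phi> \<phi>' \<Longrightarrow>
      (\<integral>x. inner (u x) h * inner (\<phi>' x) h \<partial>lebesgue_on \<Omega>) = 0"
    and S: "lipschitz_surface S" "S \<subseteq> closure \<Omega>" "\<And>x. x \<in> S \<Longrightarrow> u x = 0" and x: "x \<in> \<Omega>"
  shows "u x = 0"
proof -
  have "\<exists>a (W::real^'d^'d). (\<forall>h. inner (W *v h) h = 0) \<and> (\<forall>y\<in>\<Omega>. u y = a + W *v y)"
    by (rule weakly_strain_free_imp_rigid[OF \<Omega> continuous_on_subset[OF cont closure_subset] weak])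
  then obtain a and W :: "real^'d^'d" where skew: "\<And>h. inner (W *v h) h = 0"
    and aff: "\<And>y. y \<in> \<Omega> \<Longrightarrow> u y = a + W *v y"
    by blast
  have "continuous_on (closure \<Omega>) (\<lambda>y. u y - (a + W *v y))"
    by (intro continuous_intros cont linear_continuous_on) (simp add: linear_linear)
  then have "u y - (a + W *v y) = 0" if "y \<in> closure \<Omega>" for y
    using continuous_constant_on_closure[of \<Omega> "\<lambda>y. u y - (a + W *v y)" 0] aff that by simp
  then have "a + W *v y = 0" if "y \<in> S" for y using S that by force
  then show ?thesis using aff[OF x] rigid_zero_on_lipschitz_surface[OF S(1) skew] by simp
qed

subsection \<open>The elastic energy\<close>

lemma square_integrable_add:
  fixes f g :: "'a \<Rightarrow> 'b::euclidean_space"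
  assumes "square_integrable N f" "square_integrable N g"
  shows "square_integrable N (\<lambda>x. f x + g x)"
proof -
  have m: "f \<in> borel_measurable N" "g \<in> borel_measurable N"
    and i: "integrable N (\<lambda>x. (norm (f x))\<^sup>2)" "integrable N (\<lambda>x. (norm (g x))\<^sup>2)"
    using assms by (auto simp: square_integrable_def)
  have "integrable N (\<lambda>x. (norm (f x + g x))\<^sup>2)"
  proof (rule Bochner_Integration.integrable_bound)
    show "integrable N (\<lambda>x. 2 * (norm (f x))\<^sup>2 + 2 * (norm (g x))\<^sup>2)" using i by simp
    show "(\<lambda>x. (norm (f x + g x))\<^sup>2) \<in> borel_measurable N" using m by measurable
    have "(norm (a + b))\<^sup>2 \<le> 2 * (norm a)\<^sup>2 + 2 * (norm b)\<^sup>2" for a b :: 'b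
    proof -
      have "(norm (a + b))\<^sup>2 \<le> (norm a + norm b)\<^sup>2" by (intro power_mono norm_triangle_ineq norm_ge_zero)
      also have "\<dots> \<le> 2 * (norm a)\<^sup>2 + 2 * (norm b)\<^sup>2"
        using sum_squares_bound[of "norm a" "norm b"] by (simp add: power2_sum)
      finally show ?thesis .
    qed
    then show "AE x in N. norm ((norm (f x + g x))\<^sup>2) \<le> norm (2 * (norm (f x))\<^sup>2 + 2 * (norm (g x))\<^sup>2)"
      by (intro always_eventually) simp
  qed
  with m show ?thesis by (simp add: square_integrable_def)
qed

lemma square_integrable_scaleR:
  "square_integrable N f \<Longrightarrow> square_integrable N (\<lambda>x. c *\<^sub>R f x)"
  unfolding square_integrable_def
  by (auto simp: power_mult_distrib intro!: borel_measurable_scaleR)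

lemma square_integrable_sum:
  "(\<And>k. k \<in> K \<Longrightarrow> square_integrable N (f k)) \<Longrightarrow> square_integrable N (\<lambda>x. \<Sum>k\<in>K. f k x)"
proof (induction K rule: infinite_finite_induct)
  case (insert k K)
  then show ?case by (simp add: square_integrable_add)
qed (simp_all add: square_integrable_def)

lemma square_integrable_linear:
  fixes L :: "'a::euclidean_space \<Rightarrow> 'b::euclidean_space"
  assumes L: "linear L" and f: "square_integrable N f"
  shows "square_integrable N (\<lambda>x. L (f x))"
proof -
  have "\<exists>B. \<forall>y. norm (L y) \<le> B * norm y" by (rule linear_bounded[OF L])
  then obtain B where B: "\<forall>y. norm (L y) \<le> B * norm y" ..
  have m: "(\<lambda>x. L (f x)) \<in> borel_measurable N"
    by (rule borel_measurable_continuous_on[OF linear_continuous_on])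
      (use f L in \<open>simp_all add: square_integrable_def linear_linear\<close>)
  have "integrable N (\<lambda>x. (norm (L (f x)))\<^sup>2)"
  proof (rule Bochner_Integration.integrable_bound)
    show "integrable N (\<lambda>x. B\<^sup>2 * (norm (f x))\<^sup>2)" using f by (simp add: square_integrable_def)
    show "(\<lambda>x. (norm (L (f x)))\<^sup>2) \<in> borel_measurable N" using m by measurable
    show "AE x in N. norm ((norm (L (f x)))\<^sup>2) \<le> norm (B\<^sup>2 * (norm (f x))\<^sup>2)"
      using power_mono[OF B[rule_format] norm_ge_zero, of _ 2] by (intro always_eventually) (simp add: power_mult_distrib)
  qed
  with m show ?thesis by (simp add: square_integrable_def)
qed

lemma square_integrable_nth:
  fixes f :: "'a \<Rightarrow> 'b::euclidean_space^'n"
  shows "square_integrable N f \<Longrightarrow> square_integrable N (\<lambda>x. f x $ k)"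
  by (rule square_integrable_linear[of "\<lambda>v. v $ k"])
    (auto simp: linear_iff)

lemma square_integrable_mult:
  fixes f g :: "'a \<Rightarrow> real"
  assumes "square_integrable N f" "square_integrable N g"
  shows "integrable N (\<lambda>x. f x * g x)"
proof (rule Bochner_Integration.integrable_bound)
  show "integrable N (\<lambda>x. (f x)\<^sup>2 + (g x)\<^sup>2)" "(\<lambda>x. f x * g x) \<in> borel_measurable N"
    using assms by (auto simp: square_integrable_def)
  have "\<bar>a * b\<bar> \<le> a\<^sup>2 + b\<^sup>2" for a b :: real
    using sum_squares_bound[of a b] sum_squares_bound[of a "- b"] zero_le_power2[of a] zero_le_power2[of b]
    by (simp add: abs_le_iff)
  then show "AE x in N. norm (f x * g x) \<le> norm ((f x)\<^sup>2 + (g x)\<^sup>2)"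
    by (intro always_eventually) simp
qed

lemma essentially_bounded_mult_integrable:
  fixes f :: "'a \<Rightarrow> real"
  assumes c: "essentially_bounded N c" and f: "integrable N f"
  shows "integrable N (\<lambda>x. c x * f x)"
proof -
  obtain B where B: "AE x in N. \<bar>c x\<bar> \<le> B" and m: "c \<in> borel_measurable N"
    using c by (auto simp: essentially_bounded_def)
  show ?thesis
  proof (rule Bochner_Integration.integrable_bound)
    show "integrable N (\<lambda>x. B * f x)" using f by simp
    show "(\<lambda>x. c x * f x) \<in> borel_measurable N" using m f by measurable
    show "AE x in N. norm (c x * f x) \<le> norm (B * f x)"
      using B by eventually_elim (auto simp: abs_mult intro!: mult_right_mono)
  qed
qed

lemma AE_lebesgue_on_subset:
  assumes "A \<in> sets lebesgue" "B \<in> sets lebesgue" "A \<subseteq> B" "AE x in lebesgue_on B. P x"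
  shows "AE x in lebesgue_on A. P x"
  using assms by (auto simp: AE_restrict_space_iff elim!: eventually_mono)

lemma elasticity_tensor_subset:
  assumes "elasticity_tensor \<Omega> c c_star" "\<Omega> \<in> sets lebesgue" "\<Omega>' \<in> sets lebesgue" "\<Omega>' \<subseteq> \<Omega>"
  shows "elasticity_tensor \<Omega>' c c_star"
  using assms unfolding elasticity_tensor_def essentially_bounded_def
  by (auto intro: AE_lebesgue_on_subset[of \<Omega>' \<Omega>] measurable_restrict_mono[of _ lebesgue \<Omega> _ \<Omega>'])
    (meson AE_lebesgue_on_subset)

section \<open>Energy of a combination of basis functions\<close>

text \<open>The integrand \<sigma>(u) : e(v) as a form in two arbitrary matrices. Detached from
  displacements it is bilinear at every point.\<close>

definition tensor_form :: "'d tensor4 \<Rightarrow> real^'d \<Rightarrow> real^'d^'d \<Rightarrow> real^'d^'d \<Rightarrow> real" where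
  "tensor_form c x E F =
     (\<Sum>k\<in>UNIV. \<Sum>l\<in>UNIV. (\<Sum>m\<in>UNIV. \<Sum>n\<in>UNIV. c k l m n x * E $ m $ n) * F $ k $ l)"

lemma a_form_eq_tensor_form:
  "a_form c \<Omega> u v = (\<integral>x. tensor_form c x (strain \<Omega> u x) (strain \<Omega> v x) \<partial>lebesgue_on \<Omega>)"
  by (simp add: a_form_def tensor_form_def stress_def)

lemma bilinear_tensor_form: "bilinear (tensor_form c x)"
  unfolding bilinear_def
  by (auto intro!: linearI
    simp: tensor_form_def distrib_left distrib_right sum.distrib sum_distrib_left sum_distrib_right ac_simps)

lemma tensor_form_sum:
  fixes E :: "nat \<Rightarrow> real^'d^'d"
  shows "tensor_form c x (\<Sum>l\<in>K. v l *\<^sub>R E l) (\<Sum>k\<in>K. v k *\<^sub>R E k)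
    = (\<Sum>k\<in>K. \<Sum>l\<in>K. tensor_form c x (E l) (E k) * v l * v k)"
proof -
  have lin: "linear (\<lambda>A. tensor_form c x A B)" "linear (tensor_form c x B)" for B
    using bilinear_tensor_form[of c x] by (auto simp: bilinear_def)
  show ?thesis
    by (simp add: linear_sum[OF lin(1)] linear_sum[OF lin(2)] linear_scale[OF lin(1)]
      linear_scale[OF lin(2)] sum_distrib_left ac_simps)
qed

lemma integrable_tensor_form:
  assumes c: "\<And>k l m n. essentially_bounded N (c k l m n)"
    and E: "square_integrable N E" and F: "square_integrable N F"
  shows "integrable N (\<lambda>x. tensor_form c x (E x) (F x))"
  unfolding tensor_form_def sum_distrib_right mult.assoc
  by (intro Bochner_Integration.integrable_sum essentially_bounded_mult_integrable c
      square_integrable_mult square_integrable_nth E F)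

lemma weak_gradient_grad: "u \<in> H1 \<Omega> \<Longrightarrow> weak_gradient \<Omega> u (grad \<Omega> u)"
  unfolding grad_def H1_def using someI_ex[of "weak_gradient \<Omega> u"] by blast

lemma square_integrable_strain:
  fixes u :: "real^'d \<Rightarrow> real^'d"
  assumes "u \<in> H1 \<Omega>"
  shows "square_integrable (lebesgue_on \<Omega>) (strain \<Omega> u)"
proof -
  have "linear (\<lambda>G::real^'d^'d. (1/2) *\<^sub>R (G + transpose G))"
    by (rule linearI) (auto simp: Finite_Cartesian_Product.vec_eq_iff transpose_def algebra_simps)
  moreover have "square_integrable (lebesgue_on \<Omega>) (grad \<Omega> u)"
    using weak_gradient_grad[OF assms] by (simp add: weak_gradient_def)
  ultimately show ?thesis unfolding strain_def[abs_def] by (rule square_integrable_linear)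
qed

lemma transpose_strain: "transpose (strain \<Omega> u x) = strain \<Omega> u x"
  by (simp add: strain_def transpose_def Finite_Cartesian_Product.vec_eq_iff add.commute)

context
  fixes \<Omega> :: "(real^'d) set" and c :: "'d tensor4" and c_star :: real
    and \<psi> :: "nat \<Rightarrow> real^'d \<Rightarrow> real^'d" and n :: nat and v :: "nat \<Rightarrow> real"
  assumes tensor: "elasticity_tensor \<Omega> c c_star" and H1: "\<And>k. k < n \<Longrightarrow> \<psi> k \<in> H1 \<Omega>"
begin

text \<open>\<open>grad\<close> selects some weak gradient, so the strain of a linear combination
  need not be the combination of the strains at every point. The energy lemmas therefore speak of
  the combination itself.\<close>

private abbreviation (input) "S x \<equiv> \<Sum>k<n. v k *\<^sub>R strain \<Omega> (\<psi> k) x"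

lemma square_integrable_strain_sum: "square_integrable (lebesgue_on \<Omega>) (\<lambda>x. S x)"
  by (intro square_integrable_sum square_integrable_scaleR square_integrable_strain H1) simp

text \<open>Bilinearity expands the density pointwise; finite sums leave the integral because
  bounded coefficients times products of square-integrable strains are integrable.\<close>

lemma a_form_quadratic:
  "(\<Sum>k<n. \<Sum>l<n. a_form c \<Omega> (\<psi> l) (\<psi> k) * v l * v k)
    = (\<integral>x. tensor_form c x (S x) (S x) \<partial>lebesgue_on \<Omega>)"
proof -
  have int: "integrable (lebesgue_on \<Omega>) (\<lambda>x. tensor_form c x (strain \<Omega> (\<psi> l) x) (strain \<Omega> (\<psi> k) x))"
    if "k < n" "l < n" for k l
    using tensor that
    by (intro integrable_tensor_form square_integrable_strain H1) (auto simp: elasticity_tensor_def)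
  have "(\<integral>x. tensor_form c x (S x) (S x) \<partial>lebesgue_on \<Omega>)
      = (\<Sum>k<n. \<integral>x. (\<Sum>l<n. tensor_form c x (strain \<Omega> (\<psi> l) x) (strain \<Omega> (\<psi> k) x) * v l * v k)
          \<partial>lebesgue_on \<Omega>)"
    unfolding tensor_form_sum
    by (intro Bochner_Integration.integral_sum Bochner_Integration.integrable_sum
        integrable_mult_left int) simp_all
  also have "\<dots> = (\<Sum>k<n. \<Sum>l<n. \<integral>x. tensor_form c x (strain \<Omega> (\<psi> l) x) (strain \<Omega> (\<psi> k) x) * v l * v k
          \<partial>lebesgue_on \<Omega>)"
    by (intro sum.cong refl Bochner_Integration.integral_sum integrable_mult_left int) simp_all
  finally show ?thesis by (simp add: a_form_eq_tensor_form)
qed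

text \<open>Ellipticity is given for symmetric matrices only; \<open>S x\<close> qualifies as a
  combination of symmetric strains.\<close>

lemma tensor_form_strain_sum_coercive:
  "AE x in lebesgue_on \<Omega>. c_star * (norm (S x))\<^sup>2 \<le> tensor_form c x (S x) (S x)"
proof -
  have sym: "transpose (S x) = S x" for x
  proof -
    have "S x $ i $ j = S x $ j $ i" for i j
      using transpose_strain[of \<Omega> _ x] unfolding Finite_Cartesian_Product.vec_eq_iff transpose_def
      by simp
    then show ?thesis by (simp add: Finite_Cartesian_Product.vec_eq_iff transpose_def)
  qed
  have eq: "tensor_form c x E E =
      (\<Sum>k\<in>UNIV. \<Sum>l\<in>UNIV. \<Sum>m\<in>UNIV. \<Sum>n\<in>UNIV. c k l m n x * E $ k $ l * E $ m $ n)" for x E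
    unfolding tensor_form_def sum_distrib_right by (intro sum.cong refl) (simp add: ac_simps)
  have "AE x in lebesgue_on \<Omega>. \<forall>\<xi> :: real^'d^'d. transpose \<xi> = \<xi> \<longrightarrow>
        c_star * (norm \<xi>)\<^sup>2 \<le> tensor_form c x \<xi> \<xi>"
    using tensor unfolding elasticity_tensor_def eq by blast
  then show ?thesis by (rule eventually_mono) (use sym in simp)
qed

lemma tensor_form_strain_sum_nonneg: "AE x in lebesgue_on \<Omega>. 0 \<le> tensor_form c x (S x) (S x)"
proof (rule eventually_mono[OF tensor_form_strain_sum_coercive])
  fix x assume x: "c_star * (norm (S x))\<^sup>2 \<le> tensor_form c x (S x) (S x)"
  have "0 \<le> c_star * (norm (S x))\<^sup>2"
    using tensor by (intro mult_nonneg_nonneg zero_le_power2) (simp add: elasticity_tensor_def)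
  then show "0 \<le> tensor_form c x (S x) (S x)" using x by (rule order_trans)
qed

lemma a_form_quadratic_nonneg: "0 \<le> (\<Sum>k<n. \<Sum>l<n. a_form c \<Omega> (\<psi> l) (\<psi> k) * v l * v k)"
  unfolding a_form_quadratic by (rule integral_nonneg_AE[OF tensor_form_strain_sum_nonneg])

text \<open>A nonnegative integrand with integral 0 vanishes almost everywhere, and coercivity with
  c_star > 0 passes this on to \<open>S x\<close>.\<close>

lemma a_form_quadratic_eq_0:
  assumes "(\<Sum>k<n. \<Sum>l<n. a_form c \<Omega> (\<psi> l) (\<psi> k) * v l * v k) = 0"
  shows "AE x in lebesgue_on \<Omega>. S x = 0"
proof -
  have c: "0 < c_star" using tensor by (simp add: elasticity_tensor_def)
  have int: "integrable (lebesgue_on \<Omega>) (\<lambda>x. tensor_form c x (S x) (S x))"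
    using tensor by (intro integrable_tensor_form square_integrable_strain_sum) (auto simp: elasticity_tensor_def)
  have AE0: "AE x in lebesgue_on \<Omega>. tensor_form c x (S x) (S x) = 0"
    using assms unfolding a_form_quadratic integral_nonneg_eq_0_iff_AE[OF int tensor_form_strain_sum_nonneg] .
  have key: "A = 0" if "c_star * (norm A)\<^sup>2 \<le> t" "t = 0" for A :: "real^'d^'d" and t
    using that c by (simp add: mult_le_0_iff)
  show ?thesis
  proof (rule eventually_mono[OF eventually_conj[OF AE0 tensor_form_strain_sum_coercive]])
    fix x
    assume x: "tensor_form c x (S x) (S x) = 0 \<and> c_star * (norm (S x))\<^sup>2 \<le> tensor_form c x (S x) (S x)"
    show "S x = 0" by (rule key[OF conjunct2[OF x] conjunct1[OF x]])
  qed
qed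

end

section \<open>From vanishing energy to vanishing coefficients\<close>

lemma square_integrable_continuous:
  fixes g :: "real^'d \<Rightarrow> real"
  assumes g: "continuous_on UNIV g" and \<Omega>: "open \<Omega>" "bounded \<Omega>"
  shows "square_integrable (lebesgue_on \<Omega>) g"
proof -
  have "compact (g ` closure \<Omega>)"
    using continuous_on_subset[OF g] \<Omega>(2) by (intro compact_continuous_image) simp_all
  then obtain B where "\<forall>y\<in>g ` closure \<Omega>. norm y \<le> B"
    using compact_imp_bounded bounded_iff by metis
  then have B: "\<bar>g x\<bar> \<le> B" if "x \<in> \<Omega>" for x
    using closure_subset[of \<Omega>] that by auto
  interpret finite_measure "lebesgue_on \<Omega>"
    using \<Omega> by (intro finite_measure_lebesgue_on lmeasurable_open)
  have m: "g \<in> borel_measurable (lebesgue_on \<Omega>)"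
    using g by (intro measurable_restrict_space1 measurable_completion) (simp add: borel_measurable_continuous_onI)
  have "integrable (lebesgue_on \<Omega>) (\<lambda>x. (g x)\<^sup>2)"
  proof (rule integrable_const_bound[where B = "B\<^sup>2"])
    show "AE x in lebesgue_on \<Omega>. norm ((g x)\<^sup>2) \<le> B\<^sup>2"
      using power_mono[OF B abs_ge_zero, of _ 2] by (intro AE_I2) (simp add: space_restrict_space)
  qed (use m in measurable)
  with m show ?thesis by (simp add: square_integrable_def)
qed

text \<open>The weak gradient identity is contracted with the symmetric matrix of entries h_k h_j.
  Under this contraction the gradient and its symmetric part agree, so the strain can replace the
  gradient. The integrability claims allow sums to be split later.\<close>

lemma weak_strain:
  fixes u :: "real^'d \<Rightarrow> real^'d"
  assumes \<Omega>: "open \<Omega>" "bounded \<Omega>" and u: "u \<in> H1 \<Omega>" and \<phi>: "test_function \<Omega> \<phi> \<phi>'"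
  shows "integrable (lebesgue_on \<Omega>) (\<lambda>x. inner (u x) h * inner (\<phi>' x) h)"
    and "integrable (lebesgue_on \<Omega>) (\<lambda>x. inner (strain \<Omega> u x *v h) h * \<phi> x)"
    and "(\<integral>x. inner (u x) h * inner (\<phi>' x) h \<partial>lebesgue_on \<Omega>)
      = - (\<integral>x. inner (strain \<Omega> u x *v h) h * \<phi> x \<partial>lebesgue_on \<Omega>)"
proof -
  let ?N = "lebesgue_on \<Omega>"
  have G: "weak_gradient \<Omega> u (grad \<Omega> u)" using u by (rule weak_gradient_grad)
  have su: "square_integrable ?N u" using u by (simp add: H1_def)
  have sG: "square_integrable ?N (grad \<Omega> u)" using G by (simp add: weak_gradient_def)
  have c\<phi>': "continuous_on UNIV \<phi>'" using \<phi> by (simp add: test_function_def)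
  have c\<phi>: "continuous_on UNIV \<phi>"
    using \<phi> has_derivative_continuous unfolding test_function_def
    by (metis continuous_at_imp_continuous_on)
  have s\<phi>': "square_integrable ?N (\<lambda>x. \<phi>' x $ j)" for j
    using c\<phi>' by (intro square_integrable_continuous \<Omega> continuous_intros)
  have s\<phi>: "square_integrable ?N \<phi>" using c\<phi> \<Omega> by (rule square_integrable_continuous)
  have i1: "integrable ?N (\<lambda>x. u x $ k * \<phi>' x $ j)" for k j
    by (intro square_integrable_mult square_integrable_nth su s\<phi>')
  have i2: "integrable ?N (\<lambda>x. grad \<Omega> u x $ k $ j * \<phi> x)" for k j
    by (intro square_integrable_mult square_integrable_nth sG s\<phi>)
  have e1: "inner (u x) h * inner (\<phi>' x) h = (\<Sum>k\<in>UNIV. \<Sum>j\<in>UNIV. h $ k * h $ j * (u x $ k * \<phi>' x $ j))" for x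
    unfolding inner_vec_def sum_product by (intro sum.cong refl) simp
  have e2: "inner (strain \<Omega> u x *v h) h * \<phi> x
      = (\<Sum>k\<in>UNIV. \<Sum>j\<in>UNIV. h $ k * h $ j * (grad \<Omega> u x $ k $ j * \<phi> x))" for x
  proof -
    let ?g = "\<lambda>k j. h $ k * h $ j * (grad \<Omega> u x $ k $ j * \<phi> x)"
    have "inner (strain \<Omega> u x *v h) h * \<phi> x = (\<Sum>k\<in>UNIV. \<Sum>j\<in>UNIV. (?g k j + ?g j k) / 2)"
      by (simp add: inner_vec_def matrix_vector_mult_def strain_def transpose_def sum_distrib_right
        sum_distrib_left field_simps)
    also have "\<dots> = ((\<Sum>k\<in>UNIV. \<Sum>j\<in>UNIV. ?g k j) + (\<Sum>k\<in>UNIV. \<Sum>j\<in>UNIV. ?g j k)) / 2"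
      by (simp only: sum.distrib sum_divide_distrib add_divide_distrib)
    also have "(\<Sum>k\<in>UNIV. \<Sum>j\<in>UNIV. ?g j k) = (\<Sum>k\<in>UNIV. \<Sum>j\<in>UNIV. ?g k j)"
      by (rule sum.swap)
    finally show ?thesis by simp
  qed
  show "integrable ?N (\<lambda>x. inner (u x) h * inner (\<phi>' x) h)"
    unfolding e1 by (intro Bochner_Integration.integrable_sum integrable_mult_right i1)
  show "integrable ?N (\<lambda>x. inner (strain \<Omega> u x *v h) h * \<phi> x)"
    unfolding e2 by (intro Bochner_Integration.integrable_sum integrable_mult_right i2)
  have sum2: "(\<integral>x. (\<Sum>k\<in>UNIV. \<Sum>j\<in>UNIV. h $ k * h $ j * f k j x) \<partial>?N)
      = (\<Sum>k\<in>UNIV. \<Sum>j\<in>UNIV. h $ k * h $ j * (\<integral>x. f k j x \<partial>?N))"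
    if "\<And>k j. integrable ?N (f k j)" for f
  proof -
    have "(\<integral>x. (\<Sum>k\<in>UNIV. \<Sum>j\<in>UNIV. h $ k * h $ j * f k j x) \<partial>?N)
        = (\<Sum>k\<in>UNIV. \<integral>x. (\<Sum>j\<in>UNIV. h $ k * h $ j * f k j x) \<partial>?N)"
      by (intro Bochner_Integration.integral_sum Bochner_Integration.integrable_sum integrable_mult_right that)
    also have "\<dots> = (\<Sum>k\<in>UNIV. \<Sum>j\<in>UNIV. \<integral>x. h $ k * h $ j * f k j x \<partial>?N)"
      by (intro sum.cong refl Bochner_Integration.integral_sum integrable_mult_right that)
    finally show ?thesis by simp
  qed
  have "(\<integral>x. u x $ k * \<phi>' x $ j \<partial>?N) = - (\<integral>x. grad \<Omega> u x $ k $ j * \<phi> x \<partial>?N)" for k j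
    using G \<phi> by (simp add: weak_gradient_def)
  then show "(\<integral>x. inner (u x) h * inner (\<phi>' x) h \<partial>?N) = - (\<integral>x. inner (strain \<Omega> u x *v h) h * \<phi> x \<partial>?N)"
    unfolding e1 e2 sum2[OF i1] sum2[OF i2] by (simp add: sum_negf)
qed

text \<open>Integration by parts is applied to each \<open>\<psi> k\<close> separately; the strains
  are recombined only under the integral, where vanishing almost everywhere is enough.\<close>

lemma weakly_strain_free_sum:
  fixes \<psi> :: "nat \<Rightarrow> real^'d \<Rightarrow> real^'d"
  assumes \<Omega>: "open \<Omega>" "bounded \<Omega>" and H1: "\<And>k. k < n \<Longrightarrow> \<psi> k \<in> H1 \<Omega>"
    and S: "AE x in lebesgue_on \<Omega>. (\<Sum>k<n. v k *\<^sub>R strain \<Omega> (\<psi> k) x) = 0"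
    and \<phi>: "test_function \<Omega> \<phi> \<phi>'"
  shows "(\<integral>x. inner (\<Sum>k<n. v k *\<^sub>R \<psi> k x) h * inner (\<phi>' x) h \<partial>lebesgue_on \<Omega>) = 0"
proof -
  note w = weak_strain[OF \<Omega> H1 \<phi>, of _ h]
  have "(\<integral>x. inner (\<Sum>k<n. v k *\<^sub>R \<psi> k x) h * inner (\<phi>' x) h \<partial>lebesgue_on \<Omega>)
      = (\<integral>x. (\<Sum>k<n. v k * (inner (\<psi> k x) h * inner (\<phi>' x) h)) \<partial>lebesgue_on \<Omega>)"
    by (simp add: inner_sum_left sum_distrib_right mult.assoc)
  also have "\<dots> = (\<Sum>k<n. v k * (\<integral>x. inner (\<psi> k x) h * inner (\<phi>' x) h \<partial>lebesgue_on \<Omega>))"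
    using w(1) by (simp add: Bochner_Integration.integral_sum)
  also have "\<dots> = - (\<Sum>k<n. v k * (\<integral>x. inner (strain \<Omega> (\<psi> k) x *v h) h * \<phi> x \<partial>lebesgue_on \<Omega>))"
    using w(3) by (simp add: sum_negf)
  also have "\<dots> = - (\<integral>x. (\<Sum>k<n. v k * (inner (strain \<Omega> (\<psi> k) x *v h) h * \<phi> x)) \<partial>lebesgue_on \<Omega>)"
    using w(2) by (simp add: Bochner_Integration.integral_sum)
  also have "(\<integral>x. (\<Sum>k<n. v k * (inner (strain \<Omega> (\<psi> k) x *v h) h * \<phi> x)) \<partial>lebesgue_on \<Omega>) = 0"
  proof (rule integral_eq_zero_AE)
    have "(\<Sum>k<n. v k * (inner (strain \<Omega> (\<psi> k) x *v h) h * \<phi> x))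
        = inner ((\<Sum>k<n. v k *\<^sub>R strain \<Omega> (\<psi> k) x) *v h) h * \<phi> x" for x
    proof -
      have "linear (\<lambda>A::real^'d^'d. inner (A *v h) h * \<phi> x)"
        by (rule linearI) (auto simp: matrix_vector_mult_add_rdistrib inner_add algebra_simps
          scaleR_matrix_vector_assoc[symmetric])
      from linear_sum[OF this, of "\<lambda>k. v k *\<^sub>R strain \<Omega> (\<psi> k) x" "{..<n}"] linear_scale[OF this]
      show ?thesis by simp
    qed
    then show "AE x in lebesgue_on \<Omega>. (\<Sum>k<n. v k * (inner (strain \<Omega> (\<psi> k) x *v h) h * \<phi> x)) = 0"
      using S by (elim eventually_mono) simp
  qed
  finally show ?thesis by simp
qed

text \<open>A combination of interior basis functions vanishes on \<Gamma>, and without strain it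
  must vanish on the whole subdomain; linear independence finishes. The surface used is
  \<open>\<Gamma> \<inter> \<Omega>\<close>, since \<Gamma> may end on the outer boundary and need
  not be a graph there.\<close>

lemma strain_free_interior_coefficients_zero:
  fixes \<phi>I :: "nat \<Rightarrow> real^'d \<Rightarrow> real^'d"
  assumes dom: "two_subdomains \<Omega> \<Omega>s \<Gamma>" and i: "i \<in> {1, 2}"
    and basis: "nodal_basis (\<Omega>s i) D \<Gamma> nI \<phi>I nB \<phi>B"
    and S: "AE x in lebesgue_on (\<Omega>s i). (\<Sum>k<nI. v k *\<^sub>R strain (\<Omega>s i) (\<phi>I k) x) = 0"
    and k: "k < nI"
  shows "v k = 0"
proof -
  have lip: "lipschitz_domain (\<Omega>s i)" using dom i by (auto simp: two_subdomains_def)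
  have \<Omega>: "open (\<Omega>s i)" "connected (\<Omega>s i)" "\<Omega>s i \<noteq> {}" using lip by (auto simp: lipschitz_domain_def)
  have "\<Omega>s i \<subseteq> \<Omega>" "bounded \<Omega>" using dom i by (auto simp: two_subdomains_def)
  then have bd: "bounded (\<Omega>s i)" by (rule bounded_subset[rotated])
  have \<Gamma>: "lipschitz_surface (\<Gamma> \<inter> \<Omega>)" "\<Gamma> \<inter> \<Omega> \<subseteq> closure (\<Omega>s i)"
    using dom i by (auto simp: two_subdomains_def frontier_def)
  have H1: "\<phi>I k \<in> H1 (\<Omega>s i)" and cont: "continuous_on (closure (\<Omega>s i)) (\<phi>I k)" if "k < nI" for k
    using basis that by (auto simp: nodal_basis_def V_space_def)
  have z: "\<phi>I k x = 0" if "k < nI" "x \<in> \<Gamma>" for k x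
    using basis that by (auto simp: nodal_basis_def)
  have "(\<Sum>k<nI. v k *\<^sub>R \<phi>I k x) = 0" if "x \<in> \<Omega>s i" for x
  proof (rule weakly_strain_free_zero_on_surface[OF \<Omega> _ _ \<Gamma> _ that])
    show "continuous_on (closure (\<Omega>s i)) (\<lambda>x. \<Sum>k<nI. v k *\<^sub>R \<phi>I k x)"
      by (intro continuous_intros cont) simp
    show "(\<integral>x. inner (\<Sum>k<nI. v k *\<^sub>R \<phi>I k x) h * inner (\<phi>' x) h \<partial>lebesgue_on (\<Omega>s i)) = 0"
      if "test_function (\<Omega>s i) \<phi> \<phi>'" for \<phi> \<phi>' h
      by (rule weakly_strain_free_sum[OF \<Omega>(1) bd H1 S that])
  qed (use z in simp)
  \<comment> \<open>Independence concerns all basis functions jointly; zero interface coefficients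
    bring the combination into that form.\<close>
  then have zero: "\<forall>x\<in>\<Omega>s i. (\<Sum>k<nI. v k *\<^sub>R \<phi>I k x) + (\<Sum>k<nB. 0 *\<^sub>R \<phi>B k x) = 0" by simp
  have indep: "\<forall>k<nI. a k = 0"
    if "\<forall>x\<in>\<Omega>s i. (\<Sum>k<nI. a k *\<^sub>R \<phi>I k x) + (\<Sum>k<nB. b k *\<^sub>R \<phi>B k x) = 0" for a b
    using basis that unfolding nodal_basis_def by simp
  show ?thesis using indep[of v "\<lambda>_. 0", OF zero] k by simp
qed

subsection \<open>Matrices and the coupled system\<close>

lemma mult_mat_vec_scalar_prod:
  assumes "A \<in> carrier_mat n m" "v \<in> carrier_vec m" "w \<in> carrier_vec n"
  shows "(A *\<^sub>v v) \<bullet> w = (\<Sum>k<n. \<Sum>l<m. A $$ (k, l) * vec_index v l * vec_index w k)"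
  using assms by (auto simp: scalar_prod_def sum_distrib_right atLeast0LessThan intro!: sum.cong)

lemma form_matrix_carrier [simp]: "form_matrix a n \<phi> m \<psi> \<in> carrier_mat n m"
  by (simp add: form_matrix_def)

lemma form_matrix_form:
  assumes "v \<in> carrier_vec m" "w \<in> carrier_vec n"
  shows "(form_matrix a n \<phi> m \<psi> *\<^sub>v v) \<bullet> w
    = (\<Sum>k<n. \<Sum>l<m. a (\<psi> l) (\<phi> k) * vec_index v l * vec_index w k)"
  using assms by (subst mult_mat_vec_scalar_prod) (auto simp: form_matrix_def)

lemma form_matrix_symmetric:
  assumes "\<And>f g. a f g = a g f" "v \<in> carrier_vec n" "w \<in> carrier_vec n"
  shows "(form_matrix a n \<phi> n \<phi> *\<^sub>v v) \<bullet> w = (form_matrix a n \<phi> n \<phi> *\<^sub>v w) \<bullet> v"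
proof -
  have "(form_matrix a n \<phi> n \<phi> *\<^sub>v v) \<bullet> w
      = (\<Sum>l<n. \<Sum>k<n. a (\<phi> l) (\<phi> k) * vec_index v l * vec_index w k)"
    unfolding form_matrix_form[OF assms(2,3)] by (rule sum.swap)
  then show ?thesis unfolding form_matrix_form[OF assms(3,2)]
    using assms(1) by (simp add: mult.commute mult.left_commute)
qed

text \<open>Concatenating the two bases lets the energy lemmas, stated for a single family of
  functions, apply to the block matrix.\<close>

lemma form_matrix_four_block:
  "four_block_mat (form_matrix a n \<phi> n \<phi>) (form_matrix a n \<phi> m \<psi>)
      (form_matrix a m \<psi> n \<phi>) (form_matrix a m \<psi> m \<psi>)
    = (let \<omega> = (\<lambda>k. if k < n then \<phi> k else \<psi> (k - n)) in form_matrix a (n + m) \<omega> (n + m) \<omega>)"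
  by (rule eq_matI) (auto simp: form_matrix_def)

text \<open>The form at v - t w is a nonnegative quadratic in t, which bounds its discriminant.
  Since \<open>psd\<close> is only semidefinite, its leading coefficient \<open>c\<close> may be
  0.\<close>

lemma mat_form_cauchy_schwarz:
  assumes M: "M \<in> carrier_mat n n"
    and sym: "\<And>v w. v \<in> carrier_vec n \<Longrightarrow> w \<in> carrier_vec n \<Longrightarrow> (M *\<^sub>v v) \<bullet> w = (M *\<^sub>v w) \<bullet> v"
    and psd: "\<And>v. v \<in> carrier_vec n \<Longrightarrow> 0 \<le> (M *\<^sub>v v) \<bullet> v"
    and v: "v \<in> carrier_vec n" and w: "w \<in> carrier_vec n"
  shows "(M *\<^sub>v v) \<bullet> w \<le> mnorm M v * mnorm M w"
proof -
  define a b c where "a = (M *\<^sub>v v) \<bullet> v" and "b = (M *\<^sub>v v) \<bullet> w" and "c = (M *\<^sub>v w) \<bullet> w"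
  have Mv: "M *\<^sub>v v \<in> carrier_vec n" "M *\<^sub>v w \<in> carrier_vec n" using M v w by auto
  have q: "0 \<le> a - 2 * t * b + t\<^sup>2 * c" for t
  proof -
    have tw: "t \<cdot>\<^sub>v w \<in> carrier_vec n" "v - t \<cdot>\<^sub>v w \<in> carrier_vec n" using v w by auto
    have tMw: "t \<cdot>\<^sub>v (M *\<^sub>v w) \<in> carrier_vec n" using Mv by auto
    have "M *\<^sub>v (v - t \<cdot>\<^sub>v w) = M *\<^sub>v v - t \<cdot>\<^sub>v (M *\<^sub>v w)"
      using mult_minus_distrib_mat_vec[OF M v tw(1)] mult_mat_vec[OF M w] by simp
    then have "(M *\<^sub>v (v - t \<cdot>\<^sub>v w)) \<bullet> (v - t \<cdot>\<^sub>v w) =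
        ((M *\<^sub>v v) \<bullet> v - t * ((M *\<^sub>v v) \<bullet> w)) - (t * ((M *\<^sub>v w) \<bullet> v) - t * (t * ((M *\<^sub>v w) \<bullet> w)))"
      using minus_scalar_prod_distrib[OF Mv(1) tMw tw(2)]
        scalar_prod_minus_distrib[OF Mv(1) v tw(1)] scalar_prod_minus_distrib[OF Mv(2) v tw(1)]
        Mv v w tw by (simp add: right_diff_distrib)
    also have "\<dots> = a - 2 * t * b + t\<^sup>2 * c"
      using sym[OF w v] by (simp add: a_def b_def c_def power2_eq_square algebra_simps)
    finally show ?thesis using psd[OF tw(2)] by simp
  qed
  have a: "0 \<le> a" and c: "0 \<le> c" unfolding a_def c_def using psd v w by auto
  have "b\<^sup>2 \<le> a * c"
  proof (cases "c = 0")
    case True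
    have "b = 0"
    proof (rule ccontr)
      assume "b \<noteq> 0"
      \<comment> \<open>For \<open>c = 0\<close> the quadratic is affine in t, and this t gives the
        value -1.\<close>
      then show False using q[of "(a + 1) / (2 * b)"] True by (simp add: field_simps)
    qed
    then show ?thesis using True by simp
  next
    case False
    then have "0 < c" using c by simp
    then show ?thesis using q[of "b / c"] by (simp add: field_simps power2_eq_square)
  qed
  then have "b \<le> sqrt (a * c)" by (rule real_le_rsqrt)
  then show ?thesis by (simp add: mnorm_def a_def b_def c_def real_sqrt_mult)
qed

section \<open>Euclidean bounds for matrices\<close>

lemma vnorm_eq_L2_set: "v \<in> carrier_vec n \<Longrightarrow> vnorm v = L2_set (vec_index v) {..<n}"
  by (simp add: vnorm_def L2_set_def scalar_prod_def power2_eq_square atLeast0LessThan)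

lemma vnorm_nonneg [simp]: "0 \<le> vnorm v"
  by (simp add: vnorm_def scalar_prod_def sum_nonneg)

lemma vnorm_smult: "vnorm (c \<cdot>\<^sub>v v) = \<bar>c\<bar> * vnorm v"
  by (simp add: vnorm_def real_sqrt_mult mult.assoc[symmetric])

lemma vnorm_append:
  assumes "v \<in> carrier_vec n" "w \<in> carrier_vec m"
  shows "vnorm (v @\<^sub>v w) = sqrt ((vnorm v)\<^sup>2 + (vnorm w)\<^sup>2)"
  using scalar_prod_append[OF assms assms] vnorm_nonneg[of v] vnorm_nonneg[of w]
  unfolding vnorm_def by simp

lemma vnorm_mult_mat_vec_le:
  assumes A: "A \<in> carrier_mat n m"
  shows "\<exists>K\<ge>0. \<forall>v\<in>carrier_vec m. vnorm (A *\<^sub>v v) \<le> K * vnorm v"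
proof (intro exI[of _ "\<Sum>i<n. \<Sum>j<m. \<bar>A $$ (i, j)\<bar>"] conjI ballI)
  fix v :: "real vec" assume v: "v \<in> carrier_vec m"
  have "vnorm (A *\<^sub>v v) = L2_set (vec_index (A *\<^sub>v v)) {..<n}"
    using A v by (intro vnorm_eq_L2_set) auto
  also have "\<dots> \<le> (\<Sum>i<n. \<bar>vec_index (A *\<^sub>v v) i\<bar>)" by (rule L2_set_le_sum_abs)
  also have "\<dots> \<le> (\<Sum>i<n. \<Sum>j<m. \<bar>A $$ (i, j)\<bar> * vnorm v)"
  proof (rule sum_mono)
    fix i assume i: "i \<in> {..<n}"
    have "vec_index (A *\<^sub>v v) i = (\<Sum>j<m. A $$ (i, j) * vec_index v j)"
      using A v i by (auto simp: scalar_prod_def atLeast0LessThan)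
    also have "\<bar>\<dots>\<bar> \<le> (\<Sum>j<m. \<bar>A $$ (i, j) * vec_index v j\<bar>)" by (rule sum_abs)
    also have "\<dots> \<le> (\<Sum>j<m. \<bar>A $$ (i, j)\<bar> * vnorm v)"
    proof (rule sum_mono)
      fix j assume "j \<in> {..<m}"
      then have "\<bar>vec_index v j\<bar> \<le> vnorm v"
        using member_le_L2_set[of "{..<m}" j "\<lambda>j. \<bar>vec_index v j\<bar>"]
        by (simp add: vnorm_eq_L2_set[OF v] L2_set_def)
      then show "\<bar>A $$ (i, j) * vec_index v j\<bar> \<le> \<bar>A $$ (i, j)\<bar> * vnorm v"
        by (simp add: abs_mult mult_left_mono)
    qed
    finally show "\<bar>vec_index (A *\<^sub>v v) i\<bar> \<le> (\<Sum>j<m. \<bar>A $$ (i, j)\<bar> * vnorm v)" .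
  qed
  also have "\<dots> = (\<Sum>i<n. \<Sum>j<m. \<bar>A $$ (i, j)\<bar>) * vnorm v" by (simp add: sum_distrib_right)
  finally show "vnorm (A *\<^sub>v v) \<le> (\<Sum>i<n. \<Sum>j<m. \<bar>A $$ (i, j)\<bar>) * vnorm v" .
qed (auto intro!: sum_nonneg)

text \<open>Injectivity makes the determinant nonzero, and the adjugate identity adj(A) A = det(A) I
  turns a bound for the adjugate into one for the inverse.\<close>

lemma injective_mat_bounded_below:
  fixes A :: "real mat"
  assumes A: "A \<in> carrier_mat n n"
    and inj: "\<And>v. v \<in> carrier_vec n \<Longrightarrow> A *\<^sub>v v = 0\<^sub>v n \<Longrightarrow> v = 0\<^sub>v n"
  shows "\<exists>K\<ge>0. \<forall>v\<in>carrier_vec n. vnorm v \<le> K * vnorm (A *\<^sub>v v)"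
proof -
  have d: "det A \<noteq> 0" using det_0_iff_vec_prod_zero_field[OF A] inj by blast
  note adj = adj_mat[OF A]
  obtain K where K: "0 \<le> K" "\<forall>v\<in>carrier_vec n. vnorm (adj_mat A *\<^sub>v v) \<le> K * vnorm v"
    using vnorm_mult_mat_vec_le[OF adj(1)] by blast
  have "vnorm v \<le> K / \<bar>det A\<bar> * vnorm (A *\<^sub>v v)" if v: "v \<in> carrier_vec n" for v
  proof -
    have "adj_mat A *\<^sub>v (A *\<^sub>v v) = (adj_mat A * A) *\<^sub>v v"
      by (rule assoc_mult_mat_vec[symmetric, OF adj(1) A v])
    also have "\<dots> = det A \<cdot>\<^sub>v v"
      unfolding adj(3) using v by (auto intro!: eq_vecI simp: scalar_prod_def mult_delta_left mult_delta_right)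
    finally have "\<bar>det A\<bar> * vnorm v \<le> K * vnorm (A *\<^sub>v v)"
      using K(2)[rule_format, of "A *\<^sub>v v"] A v by (simp add: vnorm_smult)
    then show ?thesis using d by (simp add: field_simps)
  qed
  then show ?thesis using K(1) by (intro exI[of _ "K / \<bar>det A\<bar>"]) auto
qed

section \<open>Block systems and their errors\<close>

lemma four_block_add_form:
  assumes A: "AII \<in> carrier_mat n n" "AIB \<in> carrier_mat n m" "ABI \<in> carrier_mat m n"
      "ABB \<in> carrier_mat m m" and M: "M \<in> carrier_mat m m"
    and v: "vI \<in> carrier_vec n" "vB \<in> carrier_vec m"
  shows "(four_block_mat AII AIB ABI (ABB + M) *\<^sub>v (vI @\<^sub>v vB)) \<bullet> (vI @\<^sub>v vB)
    = (four_block_mat AII AIB ABI ABB *\<^sub>v (vI @\<^sub>v vB)) \<bullet> (vI @\<^sub>v vB) + (M *\<^sub>v vB) \<bullet> vB"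
proof -
  have c: "AII *\<^sub>v vI + AIB *\<^sub>v vB \<in> carrier_vec n" "ABI *\<^sub>v vI \<in> carrier_vec m"
      "ABB *\<^sub>v vB \<in> carrier_vec m" "M *\<^sub>v vB \<in> carrier_vec m"
    using A M v by auto
  have 1: "four_block_mat AII AIB ABI (ABB + M) *\<^sub>v (vI @\<^sub>v vB) =
      (AII *\<^sub>v vI + AIB *\<^sub>v vB) @\<^sub>v (ABI *\<^sub>v vI + (ABB *\<^sub>v vB + M *\<^sub>v vB))"
    using A M v by (subst four_block_mat_mult_vec[where ?nr2.0 = m]) (auto simp: add_mult_distrib_mat_vec[OF A(4) M v(2)])
  have 2: "four_block_mat AII AIB ABI ABB *\<^sub>v (vI @\<^sub>v vB) =
      (AII *\<^sub>v vI + AIB *\<^sub>v vB) @\<^sub>v (ABI *\<^sub>v vI + ABB *\<^sub>v vB)"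
    using A v by (rule four_block_mat_mult_vec)
  show ?thesis unfolding 1 2
    using c v by (subst scalar_prod_append[where ?n1.0 = n and ?n2.0 = m], auto)+
      (simp add: add_scalar_prod_distrib[where n = m] add.assoc)
qed

text \<open>The equation is tested with its own solution; the interior load is 0, so only the
  interface data remain on the right.\<close>

lemma coupled_system_energy:
  assumes A: "AII \<in> carrier_mat n n" "AIB \<in> carrier_mat n m" "ABI \<in> carrier_mat m n"
      "ABB \<in> carrier_mat m m" and M: "M \<in> carrier_mat m m"
    and v: "vI \<in> carrier_vec n" "vB \<in> carrier_vec m" and w: "w \<in> carrier_vec m"
    and sys: "four_block_mat AII AIB ABI (ABB + M) *\<^sub>v (vI @\<^sub>v vB) = 0\<^sub>v n @\<^sub>v (M *\<^sub>v w)"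
  shows "(four_block_mat AII AIB ABI ABB *\<^sub>v (vI @\<^sub>v vB)) \<bullet> (vI @\<^sub>v vB) + (M *\<^sub>v vB) \<bullet> vB = (M *\<^sub>v w) \<bullet> vB"
proof -
  have "(0\<^sub>v n @\<^sub>v (M *\<^sub>v w)) \<bullet> (vI @\<^sub>v vB) = 0\<^sub>v n \<bullet> vI + (M *\<^sub>v w) \<bullet> vB"
    using M v w by (intro scalar_prod_append) auto
  then show ?thesis using four_block_add_form[OF A M v] sys v by simp
qed

text \<open>The common loads \<open>f\<close> and \<open>g\<close> cancel. With \<open>yI\<close>,
  \<open>yB\<close> and \<open>q\<close> from the monolithic solution this is the error equation of
  a half-step.\<close>

lemma coupled_system_error:
  fixes A M :: "real mat"
  assumes A: "A \<in> carrier_mat (n + m) (n + m)" and M: "M \<in> carrier_mat m m"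
    and x: "xI \<in> carrier_vec n" "xB \<in> carrier_vec m" "yI \<in> carrier_vec n" "yB \<in> carrier_vec m"
    and p: "p \<in> carrier_vec m" "q \<in> carrier_vec m" and f: "f \<in> carrier_vec n" "g \<in> carrier_vec m"
    and eq: "A *\<^sub>v (xI @\<^sub>v xB) = f @\<^sub>v (g + M *\<^sub>v p)" "A *\<^sub>v (yI @\<^sub>v yB) = f @\<^sub>v (g + M *\<^sub>v q)"
  shows "A *\<^sub>v ((xI - yI) @\<^sub>v (xB - yB)) = 0\<^sub>v n @\<^sub>v (M *\<^sub>v (p - q))"
proof -
  have "(xI - yI) @\<^sub>v (xB - yB) = (xI @\<^sub>v xB) - (yI @\<^sub>v yB)" using x by (intro eq_vecI) auto
  also have "A *\<^sub>v \<dots> = A *\<^sub>v (xI @\<^sub>v xB) - A *\<^sub>v (yI @\<^sub>v yB)"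
    using x by (intro mult_minus_distrib_mat_vec[OF A]) auto
  also have "\<dots> = 0\<^sub>v n @\<^sub>v (M *\<^sub>v p - M *\<^sub>v q)"
    unfolding eq using f p M by (intro eq_vecI) auto
  also have "M *\<^sub>v p - M *\<^sub>v q = M *\<^sub>v (p - q)"
    using mult_minus_distrib_mat_vec[OF M p] by simp
  finally show ?thesis .
qed

text \<open>The monolithic solution is a fixed point of both half-steps: the off-diagonal coupling
  \<open>- M\<close> of each block row is moved to the right side.\<close>

lemma monolithic_solution_blocks:
  assumes sol: "monolithic_solution nI nB AII AIB ABI ABB M fI fB uI uB"
    and A: "\<And>i. i \<in> {1, 2} \<Longrightarrow> AII i \<in> carrier_mat (nI i) (nI i) \<and> AIB i \<in> carrier_mat (nI i) nB \<and>
      ABI i \<in> carrier_mat nB (nI i) \<and> ABB i \<in> carrier_mat nB nB"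
    and M: "M \<in> carrier_mat nB nB"
    and f: "\<And>i. i \<in> {1, 2} \<Longrightarrow> fI i \<in> carrier_vec (nI i) \<and> fB i \<in> carrier_vec nB"
  shows "A_tilde AII AIB ABI ABB M 1 *\<^sub>v (uI 1 @\<^sub>v uB 1) = fI 1 @\<^sub>v (fB 1 + M *\<^sub>v uB 2)"
    and "A_tilde AII AIB ABI ABB M 2 *\<^sub>v (uI 2 @\<^sub>v uB 2) = fI 2 @\<^sub>v (fB 2 + M *\<^sub>v uB 1)"
proof -
  have A1: "AII 1 \<in> carrier_mat (nI 1) (nI 1)" "AIB 1 \<in> carrier_mat (nI 1) nB"
      "ABI 1 \<in> carrier_mat nB (nI 1)" "ABB 1 \<in> carrier_mat nB nB" "ABB 1 + M \<in> carrier_mat nB nB"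
    and A2: "AII 2 \<in> carrier_mat (nI 2) (nI 2)" "AIB 2 \<in> carrier_mat (nI 2) nB"
      "ABI 2 \<in> carrier_mat nB (nI 2)" "ABB 2 \<in> carrier_mat nB nB" "ABB 2 + M \<in> carrier_mat nB nB"
    using A[of 1] A[of 2] M by auto
  have u: "uI 1 \<in> carrier_vec (nI 1)" "uB 1 \<in> carrier_vec nB" "uI 2 \<in> carrier_vec (nI 2)" "uB 2 \<in> carrier_vec nB"
    and sys: "monolithic_matrix nI nB AII AIB ABI ABB M *\<^sub>v ((uI 1 @\<^sub>v uB 1) @\<^sub>v (uB 2 @\<^sub>v uI 2))
       = (fI 1 @\<^sub>v fB 1) @\<^sub>v (fB 2 @\<^sub>v fI 2)"
    using sol by (auto simp: monolithic_solution_def)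
  have f': "fI 1 \<in> carrier_vec (nI 1)" "fB 1 \<in> carrier_vec nB" "fI 2 \<in> carrier_vec (nI 2)" "fB 2 \<in> carrier_vec nB"
    using f[of 1] f[of 2] by auto
  have zero: "0\<^sub>m k l *\<^sub>v v = 0\<^sub>v k" if "v \<in> carrier_vec l" for k l and v :: "real vec"
    using that by (intro eq_vecI) (auto simp: scalar_prod_def)
  have neg: "- M *\<^sub>v v = - (M *\<^sub>v v)" if "v \<in> carrier_vec nB" for v
    using M that by (intro eq_vecI) (auto simp: scalar_prod_def sum_negf)
  have "monolithic_matrix nI nB AII AIB ABI ABB M *\<^sub>v ((uI 1 @\<^sub>v uB 1) @\<^sub>v (uB 2 @\<^sub>v uI 2))
     = (((AII 1 *\<^sub>v uI 1 + AIB 1 *\<^sub>v uB 1) @\<^sub>v (ABI 1 *\<^sub>v uI 1 + (ABB 1 + M) *\<^sub>v uB 1))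
         + (0\<^sub>v (nI 1) @\<^sub>v (- (M *\<^sub>v uB 2))))
       @\<^sub>v (((- (M *\<^sub>v uB 1)) @\<^sub>v 0\<^sub>v (nI 2))
         + (((ABB 2 + M) *\<^sub>v uB 2 + ABI 2 *\<^sub>v uI 2) @\<^sub>v (AIB 2 *\<^sub>v uB 2 + AII 2 *\<^sub>v uI 2)))"
    unfolding monolithic_matrix_def
    using A1 A2 M u
    by (subst four_block_mat_mult_vec[where ?nr1.0 = "nI 1 + nB" and ?nc1.0 = "nI 1 + nB"
          and ?nr2.0 = "nB + nI 2" and ?nc2.0 = "nB + nI 2"])
      (auto simp: four_block_mat_mult_vec[where ?nr1.0 = "nI 1" and ?nr2.0 = nB and ?nc1.0 = "nI 1" and ?nc2.0 = nB]
        four_block_mat_mult_vec[where ?nr1.0 = "nI 1" and ?nr2.0 = nB and ?nc1.0 = nB and ?nc2.0 = "nI 2"]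
        four_block_mat_mult_vec[where ?nr1.0 = nB and ?nr2.0 = "nI 2" and ?nc1.0 = "nI 1" and ?nc2.0 = nB]
        four_block_mat_mult_vec[where ?nr1.0 = nB and ?nr2.0 = "nI 2" and ?nc1.0 = nB and ?nc2.0 = "nI 2"]
        zero neg)
  then have "(fI 1 @\<^sub>v fB 1) @\<^sub>v (fB 2 @\<^sub>v fI 2) =
      (((AII 1 *\<^sub>v uI 1 + AIB 1 *\<^sub>v uB 1) @\<^sub>v (ABI 1 *\<^sub>v uI 1 + (ABB 1 + M) *\<^sub>v uB 1))
         + (0\<^sub>v (nI 1) @\<^sub>v (- (M *\<^sub>v uB 2))))
       @\<^sub>v (((- (M *\<^sub>v uB 1)) @\<^sub>v 0\<^sub>v (nI 2))
         + (((ABB 2 + M) *\<^sub>v uB 2 + ABI 2 *\<^sub>v uI 2) @\<^sub>v (AIB 2 *\<^sub>v uB 2 + AII 2 *\<^sub>v uI 2)))"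
    (is "_ = (?x1 + ?y1) @\<^sub>v (?x2 + ?y2)")
    using sys by simp
  moreover have "?x1 + ?y1 \<in> carrier_vec (nI 1 + nB)" "fI 1 @\<^sub>v fB 1 \<in> carrier_vec (nI 1 + nB)"
    using mult_mat_vec_carrier[OF A1(5) u(2)] A1 M u f' by auto
  ultimately have blocks: "fI 1 @\<^sub>v fB 1 = ?x1 + ?y1" "fB 2 @\<^sub>v fI 2 = ?x2 + ?y2"
    using append_vec_eq by blast+
  show "A_tilde AII AIB ABI ABB M 1 *\<^sub>v (uI 1 @\<^sub>v uB 1) = fI 1 @\<^sub>v (fB 1 + M *\<^sub>v uB 2)"
  proof -
    have "A_tilde AII AIB ABI ABB M 1 *\<^sub>v (uI 1 @\<^sub>v uB 1)
      = (AII 1 *\<^sub>v uI 1 + AIB 1 *\<^sub>v uB 1) @\<^sub>v (ABI 1 *\<^sub>v uI 1 + (ABB 1 + M) *\<^sub>v uB 1)"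
      unfolding A_tilde_def by (rule four_block_mat_mult_vec) (use A1 u in auto)
    also have "\<dots> = (fI 1 @\<^sub>v fB 1) + (0\<^sub>v (nI 1) @\<^sub>v (M *\<^sub>v uB 2))"
      unfolding blocks(1) using A1 M u by (intro eq_vecI) (auto simp: carrier_vecD carrier_matD)
    also have "\<dots> = fI 1 @\<^sub>v (fB 1 + M *\<^sub>v uB 2)"
      using f' M u by (subst append_vec_add) auto
    finally show ?thesis .
  qed
  show "A_tilde AII AIB ABI ABB M 2 *\<^sub>v (uI 2 @\<^sub>v uB 2) = fI 2 @\<^sub>v (fB 2 + M *\<^sub>v uB 1)"
  proof -
    have c: "ABI 2 *\<^sub>v uI 2 \<in> carrier_vec nB" "(ABB 2 + M) *\<^sub>v uB 2 \<in> carrier_vec nB"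
      "M *\<^sub>v uB 1 \<in> carrier_vec nB" "AII 2 *\<^sub>v uI 2 \<in> carrier_vec (nI 2)" "AIB 2 *\<^sub>v uB 2 \<in> carrier_vec (nI 2)"
      by (rule mult_mat_vec_carrier[OF A2(3) u(3)] mult_mat_vec_carrier[OF A2(5) u(4)]
          mult_mat_vec_carrier[OF M u(2)] mult_mat_vec_carrier[OF A2(1) u(3)]
          mult_mat_vec_carrier[OF A2(2) u(4)])+
    have "(fB 2 @\<^sub>v fI 2) = (- (M *\<^sub>v uB 1) + ((ABB 2 + M) *\<^sub>v uB 2 + ABI 2 *\<^sub>v uI 2))
        @\<^sub>v (0\<^sub>v (nI 2) + (AIB 2 *\<^sub>v uB 2 + AII 2 *\<^sub>v uI 2))"
      unfolding blocks(2) using c by (intro append_vec_add[where m = "nI 2"]) auto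
    then have b: "fB 2 = - (M *\<^sub>v uB 1) + ((ABB 2 + M) *\<^sub>v uB 2 + ABI 2 *\<^sub>v uI 2)"
      "fI 2 = 0\<^sub>v (nI 2) + (AIB 2 *\<^sub>v uB 2 + AII 2 *\<^sub>v uI 2)"
      using c f' by (subst (asm) append_vec_eq[where n = nB]; simp)+
    have tilde: "A_tilde AII AIB ABI ABB M 2 *\<^sub>v (uI 2 @\<^sub>v uB 2)
      = (AII 2 *\<^sub>v uI 2 + AIB 2 *\<^sub>v uB 2) @\<^sub>v (ABI 2 *\<^sub>v uI 2 + (ABB 2 + M) *\<^sub>v uB 2)"
      unfolding A_tilde_def by (rule four_block_mat_mult_vec) (use A2 u in auto)
    \<comment> \<open>The second half of the monolithic system is ordered (B, I), the local one (I,
      B). The summands of each row are exchanged; the second form also cancels the coupling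
      term.\<close>
    have swap: "x + y = 0\<^sub>v n + (y + x)" "x + y = (- z + (y + x)) + z"
      if "x \<in> carrier_vec n" "y \<in> carrier_vec n" "z \<in> carrier_vec n" for x y z :: "real vec" and n
      using that by (auto intro!: eq_vecI)
    have "AII 2 *\<^sub>v uI 2 + AIB 2 *\<^sub>v uB 2 = fI 2"
      unfolding b(2) by (rule swap(1)[OF c(4,5,4)])
    moreover have "ABI 2 *\<^sub>v uI 2 + (ABB 2 + M) *\<^sub>v uB 2 = fB 2 + M *\<^sub>v uB 1"
      unfolding b(1) by (rule swap(2)[OF c(1,2,3)])
    ultimately show ?thesis using tilde by simp
  qed
qed

subsection \<open>Convergence\<close>

text \<open>\<open>E1\<close>, \<open>E2\<close> stand for M-norms of interface errors,
  \<open>x1\<close>, \<open>x2\<close> for Euclidean norms of full errors. Inserting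
  \<open>step1\<close> into the energy bound \<open>x1\<close> gives
  \<open>\<alpha> * (x1 (Suc m))\<^sup>2 \<le> r * (E2 m)\<^sup>2\<close>, the origin of sqrt (r /
  \<alpha>).\<close>

lemma gauss_seidel_rate:
  fixes E1 E2 x1 x2 :: "nat \<Rightarrow> real"
  assumes r: "0 < r" and \<alpha>: "0 < \<alpha>" and K: "0 \<le> K"
    and E: "\<And>m. 0 \<le> E2 m"
    and step1: "\<And>m. E1 (Suc m) \<le> r * E2 m" and step2: "\<And>m. E2 (Suc m) \<le> E1 (Suc m)"
    and x1: "\<And>m. \<alpha> * (x1 (Suc m))\<^sup>2 \<le> E2 m * E1 (Suc m)"
    and x2: "\<And>m. x2 (Suc m) \<le> K * x1 (Suc m)" and m: "1 \<le> m"
  shows "x1 m \<le> sqrt (r / \<alpha>) * (1 + K / r) * r ^ (m - 1) * E2 0"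
    and "x2 m \<le> sqrt (r / \<alpha>) * (1 + K / r) * r ^ m * E2 0"
proof -
  have E2: "E2 k \<le> r ^ k * E2 0" for k
  proof (induction k)
    case (Suc k)
    have "E2 (Suc k) \<le> r * E2 k" using step1[of k] step2[of k] by simp
    also have "\<dots> \<le> r * (r ^ k * E2 0)" using Suc r by simp
    finally show ?case by simp
  qed simp
  obtain k where k: "m = Suc k" using m by (cases m) auto
  define R where "R = r ^ k * E2 0"
  have R: "0 \<le> R" using r E by (simp add: R_def)
  have "\<alpha> * (x1 m)\<^sup>2 \<le> E2 k * (r * E2 k)"
    using x1[of k] mult_left_mono[OF step1[of k] E[of k]] k by simp
  also have "\<dots> \<le> r * R\<^sup>2"
    using r E[of k] E2[of k] power_mono[of "E2 k" R 2] by (simp add: R_def power2_eq_square)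
  finally have "(x1 m)\<^sup>2 \<le> r / \<alpha> * R\<^sup>2" using \<alpha> by (simp add: field_simps)
  then have "x1 m \<le> sqrt (r / \<alpha> * R\<^sup>2)" by (rule real_le_rsqrt)
  then have b: "x1 m \<le> sqrt (r / \<alpha>) * R"
    using R by (simp only: real_sqrt_mult real_sqrt_abs abs_of_nonneg)
  have sR: "0 \<le> sqrt (r / \<alpha>) * R" using r \<alpha> R by simp
  \<comment> \<open>The factor is at least 1; it is inserted so that both subdomains share one
    constant.\<close>
  have "x1 m \<le> (1 + K / r) * (sqrt (r / \<alpha>) * R)"
    using b mult_right_mono[OF _ sR, of 1 "1 + K / r"] K r by simp
  then show "x1 m \<le> sqrt (r / \<alpha>) * (1 + K / r) * r ^ (m - 1) * E2 0"
    by (simp add: R_def k ac_simps)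
  have "x2 m \<le> K * (sqrt (r / \<alpha>) * R)"
    using x2[of k] mult_left_mono[OF b K] k by simp
  also have "\<dots> \<le> (r + K) * (sqrt (r / \<alpha>) * R)"
    using r sR by (intro mult_right_mono) auto
  \<comment> \<open>\<open>x2 m\<close> inherits the power m - 1 from \<open>x1 m\<close>, while m
    is claimed; the missing \<open>r\<close> is paid for by the division in
    \<open>K / r\<close>.\<close>
  also have "r + K = (1 + K / r) * r" using r by (simp add: field_simps)
  finally show "x2 m \<le> sqrt (r / \<alpha>) * (1 + K / r) * r ^ m * E2 0"
    by (simp add: R_def k ac_simps)
qed

theorem theorem5p5:
  fixes \<Omega> \<Gamma> D :: "(real^'d) set"
    and \<Omega>s :: "nat \<Rightarrow> (real^'d) set"
    and c :: "'d tensor4" and c_star :: real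
    and \<zeta> :: "real^'d \<Rightarrow> real"
    and nI :: "nat \<Rightarrow> nat" and nB :: nat
    and \<phi>I \<phi>B :: "nat \<Rightarrow> nat \<Rightarrow> real^'d \<Rightarrow> real^'d"
    and AII AIB ABI ABB :: "nat \<Rightarrow> real mat" and M :: "real mat"
    and fI fB usI usB :: "nat \<Rightarrow> real vec"
    and \<alpha>\<^sub>1 \<beta>\<^sub>1 r :: real
  assumes dim: "CARD('d) \<in> {2, 3}"
    and domains: "two_subdomains \<Omega> \<Omega>s \<Gamma>"
    and dirichlet: "dirichlet_part \<Omega> \<Omega>s D"
    and tensor: "elasticity_tensor \<Omega> c c_star"
    and weight: "interface_weight \<Gamma> \<zeta>"
    and basis: "\<And>i. i \<in> {1, 2} \<Longrightarrow> nodal_basis (\<Omega>s i) D \<Gamma> (nI i) (\<phi>I i) nB (\<phi>B i)"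
    and matching: "\<And>k x. k < nB \<Longrightarrow> x \<in> \<Gamma> \<Longrightarrow> \<phi>B 1 k x = \<phi>B 2 k x"
    and AII: "\<And>i. i \<in> {1, 2} \<Longrightarrow>
      AII i = form_matrix (a_form c (\<Omega>s i)) (nI i) (\<phi>I i) (nI i) (\<phi>I i)"
    and AIB: "\<And>i. i \<in> {1, 2} \<Longrightarrow>
      AIB i = form_matrix (a_form c (\<Omega>s i)) (nI i) (\<phi>I i) nB (\<phi>B i)"
    and ABI: "\<And>i. i \<in> {1, 2} \<Longrightarrow>
      ABI i = form_matrix (a_form c (\<Omega>s i)) nB (\<phi>B i) (nI i) (\<phi>I i)"
    and ABB: "\<And>i. i \<in> {1, 2} \<Longrightarrow>
      ABB i = form_matrix (a_form c (\<Omega>s i)) nB (\<phi>B i) nB (\<phi>B i)"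
    and M: "\<And>i j. i \<in> {1, 2} \<Longrightarrow> j \<in> {1, 2} \<Longrightarrow>
      M = form_matrix (a_interface \<zeta> \<Gamma> (\<Omega>s j) (\<Omega>s i)) nB (\<phi>B i) nB (\<phi>B j)"
    and M_pos: "\<And>w. w \<in> carrier_vec nB \<Longrightarrow> w \<noteq> 0\<^sub>v nB \<Longrightarrow> 0 < (M *\<^sub>v w) \<bullet> w"
    and \<alpha>\<^sub>1: "0 < \<alpha>\<^sub>1"
      "\<And>vI vB. vI \<in> carrier_vec (nI 1) \<Longrightarrow> vB \<in> carrier_vec nB \<Longrightarrow>
        (A_full AII AIB ABI ABB 1 *\<^sub>v (vI @\<^sub>v vB)) \<bullet> (vI @\<^sub>v vB)
          \<ge> \<alpha>\<^sub>1 * ((vnorm vI)\<^sup>2 + (vnorm vB)\<^sup>2)"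
    and \<beta>\<^sub>1: "0 < \<beta>\<^sub>1"
      "\<And>w. w \<in> carrier_vec nB \<Longrightarrow> \<beta>\<^sub>1 * (mnorm M w)\<^sup>2 \<le> (vnorm w)\<^sup>2"
    and r: "r = 1 / (1 + \<alpha>\<^sub>1 * \<beta>\<^sub>1)"
    and loads: "\<And>i. i \<in> {1, 2} \<Longrightarrow> fI i \<in> carrier_vec (nI i) \<and> fB i \<in> carrier_vec nB"
    and solution: "monolithic_solution nI nB AII AIB ABI ABB M fI fB usI usB"
  shows "r < 1 \<and>
    (\<exists>C>0. \<forall>uI uB. gauss_seidel_iterates nI nB AII AIB ABI ABB M fI fB uI uB \<longrightarrow>
      (\<forall>i\<in>{1, 2}. \<forall>m\<ge>1.
        sqrt ((vnorm (uI i m - usI i))\<^sup>2 + (vnorm (uB i m - usB i))\<^sup>2)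
          \<le> C * r ^ (m + i - 2) * mnorm M (uB 2 0 - usB 2)))"
proof -
  \<comment> \<open>The choice i = j = 1 makes symmetry visible, as both arguments then take their
    traces from the same subdomain.\<close>
  have MM: "M = form_matrix (a_interface \<zeta> \<Gamma> (\<Omega>s 1) (\<Omega>s 1)) nB (\<phi>B 1) nB (\<phi>B 1)"
    using M by blast
  have Mc: "M \<in> carrier_mat nB nB" unfolding MM by simp
  have Msym: "(M *\<^sub>v v) \<bullet> w = (M *\<^sub>v w) \<bullet> v" if "v \<in> carrier_vec nB" "w \<in> carrier_vec nB" for v w
    unfolding MM by (rule form_matrix_symmetric[OF _ that]) (simp add: a_interface_def inner_commute)
  have Mpsd: "0 \<le> (M *\<^sub>v w) \<bullet> w" if w: "w \<in> carrier_vec nB" for w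
  proof (cases "w = 0\<^sub>v nB")
    case True
    then show ?thesis using scalar_prod_right_zero[of "M *\<^sub>v w" nB] Mc w by simp
  qed (use M_pos[OF w] in simp)
  note cs = mat_form_cauchy_schwarz[OF Mc Msym Mpsd]
  have mn0: "0 \<le> mnorm M w" and mn2: "(mnorm M w)\<^sup>2 = (M *\<^sub>v w) \<bullet> w" if "w \<in> carrier_vec nB" for w
    using Mpsd[OF that] by (auto simp: mnorm_def)
  have Ac: "AII i \<in> carrier_mat (nI i) (nI i)" "AIB i \<in> carrier_mat (nI i) nB"
      "ABI i \<in> carrier_mat nB (nI i)" "ABB i \<in> carrier_mat nB nB" if "i \<in> {1, 2}" for i
    using AII[OF that] AIB[OF that] ABI[OF that] ABB[OF that] by simp_all
  have Tc: "A_tilde AII AIB ABI ABB M i \<in> carrier_mat (nI i + nB) (nI i + nB)" if "i \<in> {1, 2}" for i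
    unfolding A_tilde_def using Ac[OF that] Mc by (intro four_block_carrier_mat) auto
  have \<alpha>\<beta>: "0 < \<alpha>\<^sub>1 * \<beta>\<^sub>1" using \<alpha>\<^sub>1(1) \<beta>\<^sub>1(1) by simp
  have r01: "0 < r" "r < 1" using \<alpha>\<beta> by (auto simp: r)

  define \<psi> where "\<psi> k = (if k < nI 2 then \<phi>I 2 k else \<phi>B 2 (k - nI 2))" for k
  let ?n = "nI 2 + nB"
  have form2: "(A_full AII AIB ABI ABB 2 *\<^sub>v v) \<bullet> v
      = (\<Sum>k<?n. \<Sum>l<?n. a_form c (\<Omega>s 2) (\<psi> l) (\<psi> k) * vec_index v l * vec_index v k)"
    if "v \<in> carrier_vec ?n" for v
    unfolding A_full_def using form_matrix_form[OF that that]
    by (simp add: AII AIB ABI ABB form_matrix_four_block Let_def \<psi>_def[abs_def])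
  have dom2: "open (\<Omega>s 2)" "\<Omega>s 2 \<subseteq> \<Omega>" "open \<Omega>"
    using domains by (auto simp: two_subdomains_def lipschitz_domain_def)
  have tensor2: "elasticity_tensor (\<Omega>s 2) c c_star"
    by (rule elasticity_tensor_subset[OF tensor]) (use dom2 in auto)
  have H2: "\<psi> k \<in> H1 (\<Omega>s 2)" if "k < ?n" for k
    using basis[of 2] that by (auto simp: \<psi>_def nodal_basis_def V_space_def)
  have psd2: "0 \<le> (A_full AII AIB ABI ABB 2 *\<^sub>v v) \<bullet> v" if "v \<in> carrier_vec ?n" for v
    unfolding form2[OF that] by (rule a_form_quadratic_nonneg[OF tensor2 H2])

  have inj: "v = 0\<^sub>v ?n" if v: "v \<in> carrier_vec ?n" and 0: "A_tilde AII AIB ABI ABB M 2 *\<^sub>v v = 0\<^sub>v ?n" for v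
  proof -
    define vI vB where "vI = vec_first v (nI 2)" and "vB = vec_last v nB"
    have vc: "vI \<in> carrier_vec (nI 2)" "vB \<in> carrier_vec nB" and veq: "v = vI @\<^sub>v vB"
      using v by (auto simp: vI_def vB_def)
    \<comment> \<open>Pairing the kernel equation with \<open>v\<close> writes 0 as elastic energy
      plus the squared M-norm of \<open>vB\<close>; both are nonnegative, so both vanish.\<close>
    have sum0: "(A_full AII AIB ABI ABB 2 *\<^sub>v v) \<bullet> v + (M *\<^sub>v vB) \<bullet> vB = 0"
    proof -
      have "(A_full AII AIB ABI ABB 2 *\<^sub>v v) \<bullet> v + (M *\<^sub>v vB) \<bullet> vB = 0\<^sub>v ?n \<bullet> v"
        unfolding 0[symmetric] unfolding veq A_full_def A_tilde_def
        by (rule four_block_add_form[symmetric]) (use Ac Mc vc in auto)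
      then show ?thesis using v by simp
    qed
    have vB0: "vB = 0\<^sub>v nB" using M_pos[OF vc(2)] psd2[OF v] sum0 by fastforce
    have "(A_full AII AIB ABI ABB 2 *\<^sub>v v) \<bullet> v = 0" using psd2[OF v] Mpsd[OF vc(2)] sum0 by linarith
    then have "AE x in lebesgue_on (\<Omega>s 2). (\<Sum>k<?n. vec_index v k *\<^sub>R strain (\<Omega>s 2) (\<psi> k) x) = 0"
      unfolding form2[OF v] by (intro a_form_quadratic_eq_0[OF tensor2 H2])
    moreover have "(\<Sum>k<?n. vec_index v k *\<^sub>R strain (\<Omega>s 2) (\<psi> k) x)
        = (\<Sum>k<nI 2. vec_index vI k *\<^sub>R strain (\<Omega>s 2) (\<phi>I 2 k) x)" for x
      unfolding veq using vc vB0 by (intro sum.mono_neutral_cong_right) (auto simp: \<psi>_def)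
    ultimately have "vec_index vI k = 0" if "k < nI 2" for k
      using strain_free_interior_coefficients_zero[OF domains _ basis[of 2] _ that] by simp
    then have "vI = 0\<^sub>v (nI 2)" using vc by (intro eq_vecI) auto
    then show ?thesis using veq vB0 by (auto intro!: eq_vecI)
  qed
  have "\<exists>K\<ge>0. \<forall>v\<in>carrier_vec ?n. vnorm v \<le> K * vnorm (A_tilde AII AIB ABI ABB M 2 *\<^sub>v v)"
    by (rule injective_mat_bounded_below[OF Tc inj]) simp
  then obtain K1 where K1: "0 \<le> K1"
    "\<forall>v\<in>carrier_vec ?n. vnorm v \<le> K1 * vnorm (A_tilde AII AIB ABI ABB M 2 *\<^sub>v v)"
    by blast
  obtain K2 where K2: "0 \<le> K2" "\<forall>v\<in>carrier_vec nB. vnorm (M *\<^sub>v v) \<le> K2 * vnorm v"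
    using vnorm_mult_mat_vec_le[OF Mc] by blast
  \<comment> \<open>\<open>K1\<close> bounds the inverse of the second local matrix and
    \<open>K2\<close> the matrix \<open>M\<close>, so that x2 is at most K1 K2 x1. All constants are
    fixed before any iterate, which makes \<open>C\<close> uniform in m and in the initial
    guess.\<close>
  define C where "C = sqrt (r / \<alpha>\<^sub>1) * (1 + K1 * K2 / r)"
  have C: "0 < C" using r01 \<alpha>\<^sub>1(1) K1(1) K2(1) by (simp add: C_def add_pos_nonneg)
  have us: "usI i \<in> carrier_vec (nI i)" "usB i \<in> carrier_vec nB" if "i \<in> {1, 2}" for i
    using solution that by (auto simp: monolithic_solution_def)
  note mono = monolithic_solution_blocks[OF solution _ Mc loads]

  have main: "sqrt ((vnorm (uI i m - usI i))\<^sup>2 + (vnorm (uB i m - usB i))\<^sup>2)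
      \<le> C * r ^ (m + i - 2) * mnorm M (uB 2 0 - usB 2)"
    if gs: "gauss_seidel_iterates nI nB AII AIB ABI ABB M fI fB uI uB" and i: "i \<in> {1, 2}" and m: "1 \<le> m"
    for uI uB i m
  proof -
    define eI eB where "eI i m = uI i m - usI i" and "eB i m = uB i m - usB i" for i m
    have gI: "uI i (Suc m) \<in> carrier_vec (nI i)" and gB: "uB i (Suc m) \<in> carrier_vec nB" if "i \<in> {1, 2}" for i m
      using gs that by (auto simp: gauss_seidel_iterates_def)
    \<comment> \<open>This sequence alone starts at index 0, with the initial guess.\<close>
    have g0: "uB 2 m \<in> carrier_vec nB" for m
      using gs gB[of 2 "m - 1"] by (cases m) (auto simp: gauss_seidel_iterates_def)
    have eIc: "eI i (Suc m) \<in> carrier_vec (nI i)" and eBc: "eB i (Suc m) \<in> carrier_vec nB" if "i \<in> {1, 2}" for i m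
      using gI[OF that] gB[OF that] us[OF that] by (auto simp: eI_def eB_def)
    have e2c: "eB 2 m \<in> carrier_vec nB" for m using g0 us[of 2] by (simp add: eB_def)
    have it: "A_tilde AII AIB ABI ABB M 1 *\<^sub>v (uI 1 (Suc m) @\<^sub>v uB 1 (Suc m)) = fI 1 @\<^sub>v (fB 1 + M *\<^sub>v uB 2 m)"
       "A_tilde AII AIB ABI ABB M 2 *\<^sub>v (uI 2 (Suc m) @\<^sub>v uB 2 (Suc m)) = fI 2 @\<^sub>v (fB 2 + M *\<^sub>v uB 1 (Suc m))" for m
      using gs[unfolded gauss_seidel_iterates_def, THEN conjunct2, rule_format, of "Suc m"] by simp_all
    have er1: "A_tilde AII AIB ABI ABB M 1 *\<^sub>v (eI 1 (Suc m) @\<^sub>v eB 1 (Suc m)) = 0\<^sub>v (nI 1) @\<^sub>v (M *\<^sub>v eB 2 m)" for m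
      unfolding eI_def eB_def
      by (rule coupled_system_error[OF Tc Mc _ _ _ _ _ _ _ _ it(1) mono(1)])
        (use gI gB g0 us loads Ac in auto)
    have er2: "A_tilde AII AIB ABI ABB M 2 *\<^sub>v (eI 2 (Suc m) @\<^sub>v eB 2 (Suc m)) = 0\<^sub>v (nI 2) @\<^sub>v (M *\<^sub>v eB 1 (Suc m))" for m
      unfolding eI_def eB_def
      by (rule coupled_system_error[OF Tc Mc _ _ _ _ _ _ _ _ it(2) mono(2)])
        (use gI gB g0 us loads Ac in auto)
    define E1 E2 x1 x2 where "E1 m = mnorm M (eB 1 m)" and "E2 m = mnorm M (eB 2 m)"
      and "x1 m = sqrt ((vnorm (eI 1 m))\<^sup>2 + (vnorm (eB 1 m))\<^sup>2)"
      and "x2 m = sqrt ((vnorm (eI 2 m))\<^sup>2 + (vnorm (eB 2 m))\<^sup>2)" for m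
    \<comment> \<open>Both terms on the left are kept: the first controls the full error, and
      together they give the contraction.\<close>
    have en1: "\<alpha>\<^sub>1 * (x1 (Suc m))\<^sup>2 + (E1 (Suc m))\<^sup>2 \<le> E2 m * E1 (Suc m)" for m
    proof -
      have "(A_full AII AIB ABI ABB 1 *\<^sub>v (eI 1 (Suc m) @\<^sub>v eB 1 (Suc m))) \<bullet> (eI 1 (Suc m) @\<^sub>v eB 1 (Suc m))
          + (E1 (Suc m))\<^sup>2 = (M *\<^sub>v eB 2 m) \<bullet> eB 1 (Suc m)"
        unfolding E1_def mn2[OF eBc[OF insertI1]] A_full_def
        by (rule coupled_system_energy[OF _ _ _ _ Mc _ _ e2c er1[unfolded A_tilde_def]]) (use Ac eIc eBc in auto)
      moreover have "(M *\<^sub>v eB 2 m) \<bullet> eB 1 (Suc m) \<le> E2 m * E1 (Suc m)"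
        unfolding E1_def E2_def using e2c eBc by (intro cs) auto
      ultimately show ?thesis using \<alpha>\<^sub>1(2)[OF eIc[OF insertI1] eBc[OF insertI1], of m m] by (simp add: x1_def)
    qed
    have E1: "0 \<le> E1 (Suc m)" and E2: "0 \<le> E2 m" for m
      unfolding E1_def E2_def using eBc[of 1 m] e2c by (auto intro!: mn0)
    have step1: "E1 (Suc m) \<le> r * E2 m" for m
    proof (cases "E1 (Suc m) = 0")
      case False
      then have pos: "0 < E1 (Suc m)" using E1[of m] by simp
      \<comment> \<open>The full error dominates its interface part, which dominates the M-norm
        through \<open>\<beta>\<^sub>1\<close>. Added to the M-norm term of \<open>en1\<close>, this
        produces the factor \<open>1 + \<alpha>\<^sub>1 * \<beta>\<^sub>1\<close>, the inverse of
        \<open>r\<close>.\<close>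
      have "\<alpha>\<^sub>1 * (\<beta>\<^sub>1 * (E1 (Suc m))\<^sup>2) \<le> \<alpha>\<^sub>1 * (vnorm (eB 1 (Suc m)))\<^sup>2"
        using \<alpha>\<^sub>1(1) \<beta>\<^sub>1(2)[OF eBc[of 1 m]] by (simp add: E1_def)
      also have "\<dots> \<le> \<alpha>\<^sub>1 * (x1 (Suc m))\<^sup>2" using \<alpha>\<^sub>1(1) by (simp add: x1_def)
      finally have "((1 + \<alpha>\<^sub>1 * \<beta>\<^sub>1) * E1 (Suc m)) * E1 (Suc m) \<le> E2 m * E1 (Suc m)"
        using en1[of m] by (simp add: power2_eq_square algebra_simps)
      then have "(1 + \<alpha>\<^sub>1 * \<beta>\<^sub>1) * E1 (Suc m) \<le> E2 m" using pos by simp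
      then show ?thesis using \<alpha>\<beta> by (simp add: r field_simps)
    qed (use r01 E2 in simp)
    have step2: "E2 (Suc m) \<le> E1 (Suc m)" for m
    proof (cases "E2 (Suc m) = 0")
      case False
      \<comment> \<open>Here the elastic energy is merely dropped as nonnegative, which leaves the
        factor 1.\<close>
      have "(A_full AII AIB ABI ABB 2 *\<^sub>v (eI 2 (Suc m) @\<^sub>v eB 2 (Suc m))) \<bullet> (eI 2 (Suc m) @\<^sub>v eB 2 (Suc m))
          + (E2 (Suc m))\<^sup>2 = (M *\<^sub>v eB 1 (Suc m)) \<bullet> eB 2 (Suc m)"
        unfolding E2_def mn2[OF e2c] A_full_def
        by (rule coupled_system_energy[OF _ _ _ _ Mc _ _ _ er2[unfolded A_tilde_def]]) (use Ac eIc eBc in auto)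
      moreover have "(M *\<^sub>v eB 1 (Suc m)) \<bullet> eB 2 (Suc m) \<le> E1 (Suc m) * E2 (Suc m)"
        unfolding E1_def E2_def using eBc by (intro cs) auto
      moreover have "0 \<le> (A_full AII AIB ABI ABB 2 *\<^sub>v (eI 2 (Suc m) @\<^sub>v eB 2 (Suc m))) \<bullet> (eI 2 (Suc m) @\<^sub>v eB 2 (Suc m))"
        using eIc[of 2 m] eBc[of 2 m] by (intro psd2) auto
      ultimately have "E2 (Suc m) * E2 (Suc m) \<le> E1 (Suc m) * E2 (Suc m)"
        by (simp add: power2_eq_square)
      moreover have "0 < E2 (Suc m)" using False E2[of "Suc m"] by simp
      ultimately show ?thesis by simp
    qed (use E1 in simp)
    have x2: "x2 (Suc m) \<le> K1 * K2 * x1 (Suc m)" for m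
    proof -
      have c1: "eB 1 (Suc m) \<in> carrier_vec nB" and c2: "eI 2 (Suc m) \<in> carrier_vec (nI 2)"
        using eBc[of 1] eIc[of 2] by simp_all
      have Mc1: "M *\<^sub>v eB 1 (Suc m) \<in> carrier_vec nB" using Mc c1 by simp
      have "x2 (Suc m) = vnorm (eI 2 (Suc m) @\<^sub>v eB 2 (Suc m))"
        unfolding x2_def by (rule vnorm_append[OF c2 e2c, symmetric])
      \<comment> \<open>By \<open>er2\<close> the second local matrix maps the error to a vector
        with zero interior part, whose interface part is \<open>M\<close> applied to the first
        error.\<close>
      also have "\<dots> \<le> K1 * vnorm (0\<^sub>v (nI 2) @\<^sub>v (M *\<^sub>v eB 1 (Suc m)))"
        using K1(2)[rule_format, of "eI 2 (Suc m) @\<^sub>v eB 2 (Suc m)"] c2 e2c by (simp add: er2)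
      also have "vnorm (0\<^sub>v (nI 2) @\<^sub>v (M *\<^sub>v eB 1 (Suc m))) = vnorm (M *\<^sub>v eB 1 (Suc m))"
        unfolding vnorm_append[OF zero_carrier_vec Mc1] by (simp add: vnorm_def[of "0\<^sub>v (nI 2)"])
      also have "K1 * \<dots> \<le> K1 * (K2 * vnorm (eB 1 (Suc m)))"
        by (rule mult_left_mono[OF K2(2)[rule_format, OF c1] K1(1)])
      also have "\<dots> \<le> K1 * (K2 * x1 (Suc m))"
        using K1(1) K2(1) by (intro mult_left_mono) (simp_all add: x1_def real_le_rsqrt)
      finally show ?thesis by (simp add: mult.assoc)
    qed
    have x1: "\<alpha>\<^sub>1 * (x1 (Suc m))\<^sup>2 \<le> E2 m * E1 (Suc m)" for m
      using en1[of m] zero_le_power2[of "E1 (Suc m)"] by linarith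
    have "0 \<le> K1 * K2" using K1(1) K2(1) by simp
    note rate = gauss_seidel_rate[where ?E1.0 = E1 and ?E2.0 = E2 and ?x1.0 = x1 and ?x2.0 = x2,
        OF r01(1) \<alpha>\<^sub>1(1) this E2 step1 step2 x1 x2 m]
    \<comment> \<open>The exponent m + i - 2 is m - 1 for i = 1, where \<open>1 \<le> m\<close>
      keeps the natural subtraction exact, and m for i = 2.\<close>
    show ?thesis
      using i rate by (auto simp: C_def x1_def x2_def E2_def eI_def eB_def)
  qed
  then show ?thesis using r01(2) C by blast
qed

end
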